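(* Let $g_0$ be a left invariant metric on the Heisenberg group $\mathrm{Nil}_3$, given with respect to a Milnor frame $\{F_1,F_2,F_3\}$ by $$g_0=A_0\,\theta^1\otimes\theta^1+B_0\,\theta^2\otimes\theta^2+C_0\,\theta^3\otimes\theta^3,\qquad A_0,B_0,C_0>0.$$ Let $g_t$, $t\in[0,\infty)$, be the solution of the Ricci flow with initial condition $g_0$. Then for every precompact domain $\Omega\subset\mathrm{Nil}_3$ with smooth boundary: (1) the function $t\mapsto \mathrm{V}(\Omega_t)\,\mathcal{T}(\Omega_t)$ is non-decreasing on $[0,\infty)$; (2) the function $t\mapsto \mathcal{T}(\Omega_t)/\mathrm{V}(\Omega_t)^3$ is non-increasing on $[0,\infty)$.
   Context: $\mathrm{Nil}_3$ is the Lie group of real upper triangular $3\times3$ matrices with $1$'s on the diagonal. $\{F_i\}$ is a Milnor frame: left invariant vector fields in which the left invariant metric is diagonal, normalized so that (up to sign) $[F_2,F_3]=2F_1$ and all other brackets $[F_i,F_j]$, $i<j$, vanish; $\{\theta^i\}$ are the dual one-forms, $\theta^i(F_j)=\delta^i_j$. With this normalization, the Ricci tensor of $A\theta^1\otimes\theta^1+B\theta^2\otimes\theta^2+C\theta^3\otimes\theta^3$ is $\frac{2A^2}{BC}\theta^1\otimes\theta^1-\frac{2A}{C}\theta^2\otimes\theta^2-\frac{2A}{B}\theta^3\otimes\theta^3$. The Ricci flow is $\frac{\partial}{\partial t}g_t=-2\,\mathrm{Ric}_{g_t}$, and the solution meant is the one that stays left invariant, $g_t=A(t)\theta^1\otimes\theta^1+B(t)\theta^2\otimes\theta^2+C(t)\theta^3\otimes\theta^3$.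 $\mathrm{V}(\Omega_t)$ is the volume of $\Omega$ with respect to $g_t$. The torsional rigidity is $\mathcal{T}(\Omega_t)=\int_\Omega E_t\,d\mathrm{V}_t$, where $d\mathrm{V}_t$ is the volume element of $g_t$ and $E_t$ solves $\Delta_{g_t}E_t=-1$ in $\Omega$, $E_t=0$ on $\partial\Omega$. *)

theory Defs
  imports "HOL-Analysis.Analysis"
begin

section \<open>Riemannian metrics in a global chart\<close>

text \<open>
  A (time-independent) metric on real^n is a function taking a base point and two
  tangent vectors.
\<close>

type_synonym 'n metric = "real^'n \<Rightarrow> real^'n \<Rightarrow> real^'n \<Rightarrow> real"

definition partial :: "('n::finite) \<Rightarrow> (real^'n \<Rightarrow> real) \<Rightarrow> real^'n \<Rightarrow> real" where
  "partial i f p = frechet_derivative f (at p) (axis i 1)"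

definition gram :: "('n::finite) metric \<Rightarrow> real^'n \<Rightarrow> real^'n^'n" where
  "gram g p = (\<chi> i j. g p (axis i 1) (axis j 1))"

definition cogram :: "('n::finite) metric \<Rightarrow> real^'n \<Rightarrow> real^'n^'n" where
  "cogram g p = matrix_inv (gram g p)"

definition vol_density :: "('n::finite) metric \<Rightarrow> real^'n \<Rightarrow> real" where
  "vol_density g p = sqrt (det (gram g p))"

definition riem_measure :: "('n::finite) metric \<Rightarrow> (real^'n) measure" where
  "riem_measure g = density lborel (\<lambda>p. ennreal (vol_density g p))"

definition riem_volume :: "('n::finite) metric \<Rightarrow> (real^'n) set \<Rightarrow> real" where
  "riem_volume g \<Omega> = measure (riem_measure g) \<Omega>"

definition laplacian :: "('n::finite) metric \<Rightarrow> (real^'n \<Rightarrow> real) \<Rightarrow> real^'n \<Rightarrow> real" where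
  "laplacian g f p =
     (\<Sum>i\<in>UNIV. partial i
        (\<lambda>q. vol_density g q * (\<Sum>j\<in>UNIV. cogram g q $ i $ j * partial j f q)) p)
     / vol_density g p"

text \<open>\<open>christoffel g k i j\<close> is the symbol with upper index \<open>k\<close> and lower indices \<open>i, j\<close>.\<close>

definition christoffel :: "('n::finite) metric \<Rightarrow> 'n \<Rightarrow> 'n \<Rightarrow> 'n \<Rightarrow> real^'n \<Rightarrow> real" where
  "christoffel g k i j p =
     (1/2) * (\<Sum>l\<in>UNIV. cogram g p $ k $ l *
        (partial i (\<lambda>q. gram g q $ j $ l) p + partial j (\<lambda>q. gram g q $ i $ l) p
         - partial l (\<lambda>q. gram g q $ i $ j) p))"

text \<open>The sign is the one for which round spheres have positive Ricci curvature.\<close>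

definition ricci_coeff :: "('n::finite) metric \<Rightarrow> 'n \<Rightarrow> 'n \<Rightarrow> real^'n \<Rightarrow> real" where
  "ricci_coeff g j k p =
     (\<Sum>i\<in>UNIV. partial i (christoffel g i j k) p - partial j (christoffel g i i k) p)
     + (\<Sum>i\<in>UNIV. \<Sum>l\<in>UNIV. christoffel g i i l p * christoffel g l j k p
                        - christoffel g i j l p * christoffel g l i k p)"

definition ricci :: "('n::finite) metric \<Rightarrow> 'n metric" where
  "ricci g p u v = (\<Sum>j\<in>UNIV. \<Sum>k\<in>UNIV. ricci_coeff g j k p * u $ j * v $ k)"

definition ricci_flow_on :: "real set \<Rightarrow> (real \<Rightarrow> ('n::finite) metric) \<Rightarrow> bool" where
  "ricci_flow_on I g \<longleftrightarrow>
     (\<forall>t\<in>I. \<forall>p u v. ((\<lambda>s. g s p u v) has_real_derivative - 2 * ricci (g t) p u v) (at t within I))"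


section \<open>Smooth domains and torsional rigidity\<close>

primrec Ck_on :: "nat \<Rightarrow> (real^('n::finite)) set \<Rightarrow> (real^'n \<Rightarrow> real) \<Rightarrow> bool" where
  "Ck_on 0 U f \<longleftrightarrow> continuous_on U f"
| "Ck_on (Suc k) U f \<longleftrightarrow>
     (\<forall>p\<in>U. f differentiable (at p)) \<and> (\<forall>i. Ck_on k U (partial i f))"

definition smooth_boundary :: "(real^('n::finite)) set \<Rightarrow> bool" where
  "smooth_boundary \<Omega> \<longleftrightarrow>
     (\<forall>p\<in>frontier \<Omega>. \<exists>U \<rho>. open U \<and> p \<in> U \<and> (\<forall>k. Ck_on k U \<rho>)
        \<and> (\<forall>q\<in>U. \<exists>i. partial i \<rho> q \<noteq> 0) \<and> \<Omega> \<inter> U = {q \<in> U. \<rho> q < 0})"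

definition precompact_smooth_domain :: "(real^('n::finite)) set \<Rightarrow> bool" where
  "precompact_smooth_domain \<Omega> \<longleftrightarrow>
     open \<Omega> \<and> connected \<Omega> \<and> \<Omega> \<noteq> {} \<and> compact (closure \<Omega>) \<and> smooth_boundary \<Omega>"

definition torsion_function :: "('n::finite) metric \<Rightarrow> (real^'n) set \<Rightarrow> (real^'n \<Rightarrow> real) \<Rightarrow> bool" where
  "torsion_function g \<Omega> E \<longleftrightarrow>
     Ck_on 2 \<Omega> E \<and> continuous_on (closure \<Omega>) E \<and>
     (\<forall>p\<in>\<Omega>. laplacian g E p = - 1) \<and> (\<forall>p\<in>frontier \<Omega>. E p = 0)"

text \<open>
  The argument \<open>E\<close> is meant to be the torsion function of \<open>\<Omega>\<close> with respect to \<open>g\<close>, i.e. the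
  classical solution of the Dirichlet problem, which is unique.
\<close>

definition torsional_rigidity :: "('n::finite) metric \<Rightarrow> (real^'n) set \<Rightarrow> (real^'n \<Rightarrow> real) \<Rightarrow> real" where
  "torsional_rigidity g \<Omega> E = (LINT p:\<Omega>|riem_measure g. E p)"


section \<open>The Heisenberg group\<close>

definition Nil3 :: "(real^3^3) set" where
  "Nil3 = {M. (\<forall>i. M $ i $ i = 1) \<and> M $ 2 $ 1 = 0 \<and> M $ 3 $ 1 = 0 \<and> M $ 3 $ 2 = 0}"

text \<open>
  Points of the group are handled through the global chart given by the entries above the
  diagonal; \<open>nil_mat\<close> is the inverse of this chart. As \<open>nil_mat\<close> is affine, topological and
  differential notions on the group are those of real^3.
\<close>

definition nil_mat :: "real^3 \<Rightarrow> real^3^3" where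
  "nil_mat p = vector [vector [1, p$1, p$3], vector [0, 1, p$2], vector [0, 0, 1]]"

definition nil_coords :: "real^3^3 \<Rightarrow> real^3" where
  "nil_coords M = vector [M$1$2, M$2$3, M$1$3]"

definition nil_mult :: "real^3 \<Rightarrow> real^3 \<Rightarrow> real^3" where
  "nil_mult p q = nil_coords (nil_mat p ** nil_mat q)"

lemma nil_coords_nil_mat [simp]: "nil_coords (nil_mat p) = p"
  by (simp add: nil_coords_def nil_mat_def vec_eq_iff forall_3)

lemma nil_mat_nil_coords: "M \<in> Nil3 \<Longrightarrow> nil_mat (nil_coords M) = M"
  by (simp add: Nil3_def nil_coords_def nil_mat_def vec_eq_iff forall_3)

lemma nil_mat_in_Nil3 [simp]: "nil_mat p \<in> Nil3"
  by (simp add: Nil3_def nil_mat_def forall_3)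

lemma bij_betw_nil_mat: "bij_betw nil_mat UNIV Nil3"
  by (rule bij_betw_byWitness[where f' = nil_coords]) (auto simp: nil_mat_nil_coords)

lemma nil_mat_nil_mult: "nil_mat (nil_mult p q) = nil_mat p ** nil_mat q"
  by (simp add: nil_mult_def nil_coords_def nil_mat_def vec_eq_iff forall_3
      matrix_matrix_mult_def sum_3)

type_synonym vector_field = "real^3 \<Rightarrow> real^3"

definition left_invariant :: "vector_field \<Rightarrow> bool" where
  "left_invariant V \<longleftrightarrow>
     (\<forall>p q. frechet_derivative (nil_mult p) (at q) (V q) = V (nil_mult p q))"

definition lie_bracket :: "vector_field \<Rightarrow> vector_field \<Rightarrow> vector_field" where
  "lie_bracket V W p =
     frechet_derivative W (at p) (V p) - frechet_derivative V (at p) (W p)"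

definition milnor_frame :: "(3 \<Rightarrow> vector_field) \<Rightarrow> bool" where
  "milnor_frame F \<longleftrightarrow>
     (\<forall>i. left_invariant (F i)) \<and> (\<forall>p. span (range (\<lambda>i. F i p)) = UNIV) \<and>
     ((\<forall>p. lie_bracket (F 2) (F 3) p = 2 *\<^sub>R F 1 p) \<or>
      (\<forall>p. lie_bracket (F 2) (F 3) p = - 2 *\<^sub>R F 1 p)) \<and>
     (\<forall>p. lie_bracket (F 1) (F 2) p = 0) \<and> (\<forall>p. lie_bracket (F 1) (F 3) p = 0)"

definition dual_coframe :: "(3 \<Rightarrow> vector_field) \<Rightarrow> (3 \<Rightarrow> real^3 \<Rightarrow> real^3 \<Rightarrow> real) \<Rightarrow> bool" where
  "dual_coframe F \<theta> \<longleftrightarrow>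
     (\<forall>i p. linear (\<theta> i p) \<and> (\<forall>j. \<theta> i p (F j p) = (if i = j then 1 else 0)))"

definition diag_metric ::
    "(3 \<Rightarrow> real^3 \<Rightarrow> real^3 \<Rightarrow> real) \<Rightarrow> real \<Rightarrow> real \<Rightarrow> real \<Rightarrow> 3 metric" where
  "diag_metric \<theta> a b c p u v =
     a * (\<theta> 1 p u * \<theta> 1 p v) + b * (\<theta> 2 p u * \<theta> 2 p v) + c * (\<theta> 3 p u * \<theta> 3 p v)"

end

theory Submission
  imports Defs
begin

text \<open>
  Along the flow \<open>A B\<close> and \<open>A C\<close> are constant while \<open>B C\<close> increases. The volume density is a constant
  multiple of \<open>sqrt (A B C)\<close> and the cometric is \<open>F\<^sub>1\<^sup>2/A + F\<^sub>2\<^sup>2/B + F\<^sub>3\<^sup>2/C\<close>, so the cometric divided by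
  \<open>A B C\<close> is non-increasing in time, while the cometric multiplied by \<open>A B C\<close> is non-decreasing.
  Both claims therefore follow from a comparison principle: if \<open>div (K \<nabla>u) = -1\<close>, \<open>div (L \<nabla>v) = -1\<close> with
  zero boundary values and \<open>L \<le> c K\<close>, then \<open>\<integral>u \<le> c \<integral>v\<close>. To prove it, test both equations with \<open>u\<close>:
  \<open>2 \<integral>u = 2 \<integral>L \<nabla>v \<cdot> \<nabla>u \<le> c \<integral>L \<nabla>v \<cdot> \<nabla>v + (1/c) \<integral>L \<nabla>u \<cdot> \<nabla>u \<le> c \<integral>v + \<integral>u\<close>.
\<close>

section \<open>Partial derivatives\<close>

text \<open>A torsion function is only C^2 inside the domain and continuous on the closure, so u is
  not a compactly supported test function and the energies in the chain of inequalities are not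
  known to be finite. The chain is therefore run with w = \<open>cutoff e (u p)\<close>. The maximum
  principle gives u >= 0, which keeps w between u - 2 e and u. The gradient of w is a times that of
  u with 0 <= a <= 1, and a^2 <= a lets the last energy be absorbed. The energy of v is taken only
  over a compact set, where it is at most the integral of v. Finally e tends to 0. The exponents in
  the two claims come from the density: in the chart, V = \<rho> m and T = \<rho> J, where m is the
  Lebesgue measure, J the Lebesgue integral of the torsion function and \<rho>^2 is proportional to
  A B C. So V T = m \<rho>^2 J and T / V^3 = J / (\<rho>^2 m^3). Both claims use the comparison with
  the same c, the quotient of the values of A B C at the two times; the times swap their roles of u
  and v.\<close>

lemma partial_eqI: "(f has_derivative D) (at p) \<Longrightarrow> partial i f p = D (axis i 1)"
  unfolding partial_def using frechet_derivative_at by metis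

text \<open>\<open>frechet_derivative\<close> selects some D satisfying
  \<open>has_derivative\<close>. Functions that agree near p have the same such D, so the selected
  values agree even where no derivative exists.\<close>

lemma partial_cong:
  assumes "open U" "p \<in> U" "\<And>q. q \<in> U \<Longrightarrow> f q = g q"
  shows "partial i f p = partial i g p"
proof -
  have "(f has_derivative D) (at p) \<longleftrightarrow> (g has_derivative D) (at p)" for D
    using assms has_derivative_transform_within_open[of f D p UNIV U g]
      has_derivative_transform_within_open[of g D p UNIV U f] by auto
  then show ?thesis
    by (simp add: partial_def frechet_derivative_def)
qed

lemma partial_const: "partial i (\<lambda>_. c) p = 0"
  by (simp add: partial_def)

lemma partial_mult:
  assumes "f differentiable (at p)" "g differentiable (at p)"
  shows "partial i (\<lambda>q. f q * g q) p = f p * partial i g p + partial i f p * g p"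
  by (subst partial_eqI[OF has_derivative_mult[OF assms[unfolded frechet_derivative_works]]])
    (simp add: partial_def)

lemma partial_sum:
  assumes "\<And>k. k \<in> S \<Longrightarrow> f k differentiable (at p)"
  shows "partial i (\<lambda>q. \<Sum>k\<in>S. f k q) p = (\<Sum>k\<in>S. partial i (f k) p)"
  by (subst partial_eqI[OF has_derivative_sum[where f' = "\<lambda>k. frechet_derivative (f k) (at p)"]])
    (use assms frechet_derivative_works in \<open>auto simp: partial_def\<close>)

lemma partial_compose:
  assumes "f differentiable (at p)" "(\<phi> has_real_derivative c) (at (f p))"
  shows "partial i (\<lambda>q. \<phi> (f q)) p = c * partial i f p"
proof -
  have "(f has_derivative frechet_derivative f (at p)) (at p)"
    using assms(1) frechet_derivative_works by blast
  from has_derivative_compose[OF this assms(2)[unfolded has_field_derivative_def]]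
  show ?thesis
    by (subst partial_eqI) (auto simp: partial_def)
qed

lemma has_real_derivative_along_axis:
  fixes f :: "real^'n \<Rightarrow> real"
  assumes "f differentiable (at (p + s *\<^sub>R axis i 1))"
  shows "((\<lambda>s. f (p + s *\<^sub>R axis i 1)) has_real_derivative partial i f (p + s *\<^sub>R axis i 1)) (at s)"
proof -
  let ?D = "frechet_derivative f (at (p + s *\<^sub>R axis i 1))"
  have "(f has_derivative ?D) (at (p + s *\<^sub>R axis i 1))"
    using assms frechet_derivative_works by blast
  then have "((\<lambda>s. f (p + s *\<^sub>R axis i 1)) has_derivative (\<lambda>h. ?D (h *\<^sub>R axis i 1))) (at s)"
    by (rule has_derivative_compose[rotated]) (auto intro!: derivative_eq_intros)
  moreover have "?D (h *\<^sub>R axis i 1) = h * partial i f (p + s *\<^sub>R axis i 1)" for h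
    using linear_frechet_derivative[OF assms] by (simp add: partial_def linear_scale)
  ultimately show ?thesis
    by (simp add: has_field_derivative_def mult_commute_abs)
qed

section \<open>Calculus of C^1 and C^2 functions on a set\<close>

lemma Ck_on_2_D:
  assumes "Ck_on 2 U f"
  shows "\<And>p. p \<in> U \<Longrightarrow> f differentiable (at p)" "\<And>i. Ck_on 1 U (partial i f)"
  using assms by (simp_all add: numeral_2_eq_2)

lemma Ck_on_1_D:
  assumes "Ck_on 1 U f"
  shows "\<And>p. p \<in> U \<Longrightarrow> f differentiable (at p)" "\<And>i. continuous_on U (partial i f)"
    "continuous_on U f"
proof -
  show *: "\<And>p. p \<in> U \<Longrightarrow> f differentiable (at p)" "\<And>i. continuous_on U (partial i f)"
    using assms by simp_all
  show "continuous_on U f"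
    by (meson * continuous_at_imp_continuous_on differentiable_imp_continuous_within)
qed

lemma Ck_on_1_I:
  "(\<And>p. p \<in> U \<Longrightarrow> f differentiable (at p)) \<Longrightarrow> (\<And>i. continuous_on U (partial i f)) \<Longrightarrow> Ck_on 1 U f"
  by simp

lemma Ck_on_1_mult:
  assumes "Ck_on 1 U f" "Ck_on 1 U g"
  shows "Ck_on 1 U (\<lambda>p. f p * g p)"
proof (rule Ck_on_1_I)
  fix i
  have "continuous_on U (\<lambda>p. f p * partial i g p + partial i f p * g p)"
    using Ck_on_1_D(2,3)[OF assms(1)] Ck_on_1_D(2,3)[OF assms(2)] by (intro continuous_intros)
  then show "continuous_on U (partial i (\<lambda>p. f p * g p))"
    by (rule continuous_on_eq) (use Ck_on_1_D(1)[OF assms(1)] Ck_on_1_D(1)[OF assms(2)]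
        in \<open>simp add: partial_mult\<close>)
qed (use assms in auto)

lemma Ck_on_1_sum:
  assumes "\<And>k. k \<in> S \<Longrightarrow> Ck_on 1 U (f k)" and "finite S"
  shows "Ck_on 1 U (\<lambda>p. \<Sum>k\<in>S. f k p)"
proof (rule Ck_on_1_I)
  fix i
  have "continuous_on U (\<lambda>p. \<Sum>k\<in>S. partial i (f k) p)"
    using Ck_on_1_D(2)[OF assms(1)] by (intro continuous_intros)
  then show "continuous_on U (partial i (\<lambda>p. \<Sum>k\<in>S. f k p))"
    by (rule continuous_on_eq) (use Ck_on_1_D(1)[OF assms(1)] in \<open>simp add: partial_sum\<close>)
qed (use Ck_on_1_D(1)[OF assms(1)] assms(2) in auto)

lemma partial_eq_0_of_vanishing:
  assumes "open U" "p \<in> U" "\<And>q. q \<in> U \<Longrightarrow> f q = 0"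
  shows "partial i f p = 0"
  by (subst partial_cong[where g = "\<lambda>_. 0", OF assms]) (auto simp: partial_def)

section \<open>Integration by parts\<close>

text \<open>Difference quotients in direction i have integral 0 by translation invariance of
  \<open>lborel\<close>. They converge to the partial derivative, and the mean value theorem
  supplies the dominating function.\<close>

lemma integral_partial_eq_0:
  fixes f :: "real^'n \<Rightarrow> real"
  assumes diff: "\<And>p. f differentiable (at p)" and cont: "continuous_on UNIV (partial i f)"
    and K: "compact K" and f0: "\<And>p. p \<notin> K \<Longrightarrow> f p = 0"
  shows "(LINT p|lborel. partial i f p) = 0"
proof -
  let ?e = "axis i 1 :: real^'n"
  have fcont: "continuous_on UNIV f"
    using diff by (simp add: continuous_at_imp_continuous_on differentiable_imp_continuous_within)
  have p0: "partial i f p = 0" if "p \<notin> K" for p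
    using partial_eq_0_of_vanishing[of "-K" p f i] that f0 K by (auto simp: compact_imp_closed open_Compl)
  obtain M where M: "\<And>p. p \<in> K \<Longrightarrow> norm (partial i f p) \<le> M" and M0: "M > 0"
  proof -
    have "compact (partial i f ` K)"
      using K cont by (meson compact_continuous_image continuous_on_subset subset_UNIV)
    then have "bounded (partial i f ` K)" by (rule compact_imp_bounded)
    then show ?thesis using that unfolding bounded_pos by blast
  qed
  have M': "norm (partial i f p) \<le> M" for p
    using M[of p] p0[of p] M0 by (cases "p \<in> K") auto
  obtain R where R: "K \<subseteq> cball 0 R"
    using compact_imp_bounded[OF K] by (auto simp: bounded_iff subset_eq)
  define q where "q n p = (f (p + (1 / Suc n) *\<^sub>R ?e) - f p) / (1 / Suc n)" for n :: nat and p
  have fint: "integrable lborel f"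
  proof -
    have "integrable lborel (\<lambda>x. indicator K x *\<^sub>R f x)"
      by (rule borel_integrable_compact[OF K]) (use fcont continuous_on_subset in blast)
    also have "(\<lambda>x. indicator K x *\<^sub>R f x) = f"
      using f0 by (fastforce simp: indicator_def fun_eq_iff)
    finally show ?thesis .
  qed
  have transl: "integrable lborel (\<lambda>p. f (p + c))" "(LINT p|lborel. f (p + c)) = (LINT p|lborel. f p)" for c
  proof -
    have [measurable]: "f \<in> borel_measurable borel" using fcont by (rule borel_measurable_continuous_onI)
    have "integrable (distr lborel borel ((+) c)) f" using fint by (simp only: lborel_distr_plus)
    then show "integrable lborel (\<lambda>p. f (p + c))"
      by (subst (asm) integrable_distr_eq) (auto simp: add.commute)
    have "(LINT p|lborel. f p) = (LINT p|distr lborel borel ((+) c). f p)"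
      by (simp only: lborel_distr_plus)
    also have "\<dots> = (LINT p|lborel. f (c + p))" by (rule integral_distr) auto
    finally show "(LINT p|lborel. f (p + c)) = (LINT p|lborel. f p)" by (simp add: add.commute)
  qed
  have q0: "(LINT p|lborel. q n p) = 0" for n
    unfolding q_def using transl fint by simp
  have "(\<lambda>n. LINT p|lborel. q n p) \<longlonglongrightarrow> (LINT p|lborel. partial i f p)"
  \<comment> \<open>The shifts have length at most 1, so every \<open>q n\<close> vanishes outside
    the ball of radius R + 1.\<close>
  proof (rule integral_dominated_convergence[where w = "\<lambda>p. indicator (cball 0 (R + 1)) p *\<^sub>R M"])
    show "partial i f \<in> borel_measurable lborel"
      using borel_measurable_continuous_onI[OF cont] by simp
    show "q n \<in> borel_measurable lborel" for n
      unfolding q_def using transl(1) fint by (intro borel_measurable_divide borel_measurable_diff) auto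
    show "integrable lborel (\<lambda>p. indicator (cball 0 (R + 1)) p *\<^sub>R M :: real)"
      by (rule borel_integrable_compact) auto
    show "AE p in lborel. (\<lambda>n. q n p) \<longlonglongrightarrow> partial i f p"
    proof (rule AE_I2)
      fix p :: "real^'n"
      have "((\<lambda>s. f (p + s *\<^sub>R ?e)) has_real_derivative partial i f p) (at 0)"
        using has_real_derivative_along_axis[of f p 0 i] diff by simp
      then have "((\<lambda>s. (f (p + s *\<^sub>R ?e) - f p) / s) \<longlongrightarrow> partial i f p) (at 0)"
        by (simp add: DERIV_def)
      moreover have "filterlim (\<lambda>n. 1 / real (Suc n)) (at 0) sequentially"
        using LIMSEQ_inverse_real_of_nat by (intro filterlim_atI) (auto simp: inverse_eq_divide)
      ultimately show "(\<lambda>n. q n p) \<longlonglongrightarrow> partial i f p"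
        unfolding q_def by (rule filterlim_compose)
    qed
    show "AE p in lborel. norm (q n p) \<le> indicator (cball 0 (R + 1)) p *\<^sub>R M" for n
    proof (rule AE_I2)
      fix p :: "real^'n"
      let ?s = "1 / real (Suc n)"
      have s: "?s > 0" "?s \<le> 1" by auto
      show "norm (q n p) \<le> indicator (cball 0 (R + 1)) p *\<^sub>R M"
      proof (cases "p \<in> cball 0 (R + 1)")
        case True
        have "\<exists>z. 0 < z \<and> z < ?s \<and> f (p + ?s *\<^sub>R ?e) - f (p + 0 *\<^sub>R ?e) = (?s - 0) * partial i f (p + z *\<^sub>R ?e)"
          by (rule MVT2[OF s(1)]) (use has_real_derivative_along_axis diff in blast)
        then obtain z where "f (p + ?s *\<^sub>R ?e) - f p = ?s * partial i f (p + z *\<^sub>R ?e)"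
          by auto
        then have "q n p = partial i f (p + z *\<^sub>R ?e)"
          using s(1) by (simp add: q_def)
        then show ?thesis using M' True by simp
      next
        case False
        then have n: "norm p > R + 1" by simp
        have e1: "norm (?s *\<^sub>R ?e) = ?s" using s by simp
        have "norm p \<le> norm (p + ?s *\<^sub>R ?e) + norm (?s *\<^sub>R ?e)"
          by (metis norm_triangle_ineq4 add_diff_cancel)
        then have "norm (p + ?s *\<^sub>R ?e) > R" using n s e1 by linarith
        then have "f (p + ?s *\<^sub>R ?e) = 0" "f p = 0" using R n f0 by (force)+
        then show ?thesis by (simp add: q_def M0 less_imp_le)
      qed
    qed
  qed
  then show ?thesis using q0 LIMSEQ_unique[of "\<lambda>_. 0::real"] by simp
qed

text \<open>The open sets U and - K cover the space because K lies in U, and the extension is 0 on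
  the second one.\<close>

lemma continuous_on_extend_0:
  fixes f :: "'a::t2_space \<Rightarrow> 'b::{topological_space,zero}"
  assumes "open U" "compact K" "K \<subseteq> U" "continuous_on U f" "\<And>p. p \<in> U - K \<Longrightarrow> f p = 0"
  shows "continuous_on UNIV (\<lambda>p. if p \<in> U then f p else 0)"
proof -
  have "continuous_on (U \<union> - K) (\<lambda>p. if p \<in> U then f p else 0)"
  proof (rule continuous_on_open_Un)
    show "continuous_on U (\<lambda>p. if p \<in> U then f p else 0)"
      by (rule continuous_on_eq[OF assms(4)]) auto
    show "continuous_on (- K) (\<lambda>p. if p \<in> U then f p else 0)"
      by (rule continuous_on_eq[of _ "\<lambda>_. 0"]) (use assms(5) in auto)
  qed (use assms compact_imp_closed in auto)
  moreover have "U \<union> - K = UNIV" using assms(3) by auto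
  ultimately show ?thesis by simp
qed

lemma set_integrable_compact_support:
  fixes f :: "real^'n \<Rightarrow> real"
  assumes "open U" "compact K" "K \<subseteq> U" "continuous_on U f" "\<And>p. p \<in> U - K \<Longrightarrow> f p = 0"
  shows "set_integrable lborel U f"
proof -
  have "integrable lborel (\<lambda>p. indicator K p *\<^sub>R f p)"
    by (rule borel_integrable_compact) (use assms continuous_on_subset in auto)
  also have "(\<lambda>p. indicator K p *\<^sub>R f p) = (\<lambda>p. indicator U p *\<^sub>R f p)"
    using assms(3,5) by (fastforce simp: indicator_def)
  finally show ?thesis by (simp add: set_integrable_def)
qed

text \<open>Extended by zero, f is C^1 on the whole space and vanishes off K, so
  \<open>integral_partial_eq_0\<close> applies to the extension.\<close>

lemma set_integral_partial_eq_0: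
  fixes f :: "real^'n \<Rightarrow> real"
  assumes U: "open U" "compact K" "K \<subseteq> U" and f: "Ck_on 1 U f" and f0: "\<And>p. p \<in> U - K \<Longrightarrow> f p = 0"
  shows "(LINT p:U|lborel. partial i f p) = 0"
proof -
  let ?F = "\<lambda>p. if p \<in> U then f p else 0"
  have part: "partial i ?F p = (if p \<in> U then partial i f p else 0)" for p
  proof (cases "p \<in> U")
    case True
    then show ?thesis using partial_cong[OF U(1) True, of ?F f i] by simp
  next
    case False
    then show ?thesis using U f0
      by (auto intro!: partial_eq_0_of_vanishing[of "-K"] simp: compact_imp_closed open_Compl)
  qed
  have "(LINT p|lborel. partial i ?F p) = 0"
  proof (rule integral_partial_eq_0[OF _ _ U(2)])
    show "?F differentiable (at p)" for p
    proof (cases "p \<in> U")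
      case True
      then have "(f has_derivative frechet_derivative f (at p)) (at p)"
        using Ck_on_1_D(1)[OF f] frechet_derivative_works by blast
      then have "(?F has_derivative frechet_derivative f (at p)) (at p)"
        by (rule has_derivative_transform_within_open[OF _ U(1) True]) auto
      then show ?thesis by (auto simp: differentiable_def)
    next
      case False
      have "(?F has_derivative (\<lambda>_. 0)) (at p)"
        by (rule has_derivative_transform_within_open[of "\<lambda>_. 0" _ _ _ "-K"])
          (use False U f0 in \<open>auto simp: compact_imp_closed open_Compl\<close>)
      then show ?thesis by (auto simp: differentiable_def)
    qed
    have "continuous_on UNIV (\<lambda>p. if p \<in> U then partial i f p else 0)"
    proof (rule continuous_on_extend_0[OF U])
      show "partial i f p = 0" if "p \<in> U - K" for p
        using that partial_eq_0_of_vanishing[of "U - K" p f i] f0 U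
        by (auto simp: compact_imp_closed open_Diff)
    qed (rule Ck_on_1_D(2)[OF f])
    then show "continuous_on UNIV (partial i ?F)" by (simp add: part)
  qed (use f0 U(3) in auto)
  then show ?thesis
    unfolding part set_lebesgue_integral_def
    by (simp add: if_distrib[of "\<lambda>c. c * _"] indicator_def of_bool_def cong: if_cong)
qed

text \<open>Gradient and divergence are those of the flat chart; a metric enters only through the
  matrix applied to \<open>grad\<close>.\<close>

definition grad :: "(real^('n::finite) \<Rightarrow> real) \<Rightarrow> real^'n \<Rightarrow> real^'n" where
  "grad f p = (\<chi> i. partial i f p)"

lemma grad_nth [simp]: "grad f p $ i = partial i f p"
  by (simp add: grad_def)

definition divergence :: "(real^('n::finite) \<Rightarrow> real^'n) \<Rightarrow> real^'n \<Rightarrow> real" where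
  "divergence X p = (\<Sum>i\<in>UNIV. partial i (\<lambda>q. X q $ i) p)"

text \<open>The two integrands, both brought to one side, add up to the divergence of w X, whose
  components vanish off K and so leave no boundary term.\<close>

lemma integral_by_parts:
  fixes w :: "real^'n \<Rightarrow> real" and X :: "real^'n \<Rightarrow> real^'n"
  assumes U: "open U" "compact K" "K \<subseteq> U" and w: "Ck_on 1 U w" and w0: "\<And>p. p \<in> U - K \<Longrightarrow> w p = 0"
    and X: "\<And>i. Ck_on 1 U (\<lambda>p. X p $ i)"
  shows "(LINT p:U|lborel. w p * divergence X p) = - (LINT p:U|lborel. X p \<bullet> grad w p)"
proof -
  note dw = Ck_on_1_D[OF w] and dX = Ck_on_1_D[OF X]
  have gw0: "partial i w p = 0" if "p \<in> U - K" for i p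
    using that partial_eq_0_of_vanishing[of "U - K" p w i] w0 U
    by (auto simp: compact_imp_closed open_Diff)
  have i1: "set_integrable lborel U (\<lambda>p. w p * divergence X p)"
    by (rule set_integrable_compact_support[OF U])
      (auto simp: w0 divergence_def intro!: continuous_intros dw dX)
  have i2: "set_integrable lborel U (\<lambda>p. X p \<bullet> grad w p)"
    unfolding inner_vec_def
    by (rule set_integrable_compact_support[OF U])
      (auto simp: gw0 intro!: continuous_intros dw dX)
  have i3: "set_integrable lborel U (\<lambda>p. partial i (\<lambda>q. w q * X q $ i) p)" for i
  proof (rule set_integrable_compact_support[OF U])
    show "continuous_on U (partial i (\<lambda>q. w q * X q $ i))"
      using Ck_on_1_D(2)[OF Ck_on_1_mult[OF w X]] .
  qed (use w0 gw0 dw dX in \<open>simp add: partial_mult\<close>)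
  have "(LINT p:U|lborel. w p * divergence X p) + (LINT p:U|lborel. X p \<bullet> grad w p)
      = (LINT p:U|lborel. w p * divergence X p + X p \<bullet> grad w p)"
    using i1 i2 by (simp add: set_integral_add)
  also have "\<dots> = (LINT p:U|lborel. (\<Sum>i\<in>UNIV. partial i (\<lambda>q. w q * X q $ i) p))"
  proof (rule set_lebesgue_integral_cong)
    show "\<forall>p. p \<in> U \<longrightarrow> w p * divergence X p + X p \<bullet> grad w p
      = (\<Sum>i\<in>UNIV. partial i (\<lambda>q. w q * X q $ i) p)"
      using dw dX by (simp add: partial_mult divergence_def inner_vec_def sum_distrib_left sum.distrib mult.commute)
  qed (use U in auto)
  also have "\<dots> = (\<Sum>i\<in>UNIV. (LINT p:U|lborel. partial i (\<lambda>q. w q * X q $ i) p))"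
    using i3 unfolding set_lebesgue_integral_def set_integrable_def scaleR_sum_right
    by (subst Bochner_Integration.integral_sum) auto
  also have "\<dots> = 0"
    using set_integral_partial_eq_0[OF U Ck_on_1_mult[OF w X]] w0 by simp
  finally show ?thesis by simp
qed

section \<open>Comparison of Dirichlet problems\<close>

text \<open>A \<open>C\<^sup>1\<close> truncation of the identity. Composing it with a function that vanishes on the boundary
  gives a compactly supported test function, so that no regularity up to the boundary is needed.\<close>

definition cutoff :: "real \<Rightarrow> real \<Rightarrow> real" where
  "cutoff e s = ((max 0 (s - e))\<^sup>2 - (max 0 (s - 2 * e))\<^sup>2) / (2 * e)"

text \<open>This is the derivative of \<open>cutoff e\<close>: 0 up to e, rising linearly to 1 at 2
  e, then constant.\<close>

definition cutoff' :: "real \<Rightarrow> real \<Rightarrow> real" where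
  "cutoff' e s = (max 0 (s - e) - max 0 (s - 2 * e)) / e"

lemma has_real_derivative_max_0_power2:
  fixes s :: real
  shows "((\<lambda>s. (max 0 s)\<^sup>2) has_real_derivative 2 * max 0 s) (at s)"
proof (cases "s = 0")
  case True
  \<comment> \<open>At the kink the difference quotient is bounded by the size of the
    increment.\<close>
  have "((\<lambda>h. max 0 h * (max 0 h / h)) \<longlongrightarrow> 0) (at (0::real))"
  proof (rule Lim_null_comparison[where g = "\<lambda>h. \<bar>h\<bar>"])
    show "\<forall>\<^sub>F h in at (0::real). norm (max 0 h * (max 0 h / h)) \<le> \<bar>h\<bar>"
      by (rule always_eventually) (auto simp: max_def)
    show "((\<lambda>h::real. \<bar>h\<bar>) \<longlongrightarrow> 0) (at 0)"
      using tendsto_rabs[OF tendsto_ident_at[of "0::real"]] by simp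
  qed
  then show ?thesis using True by (simp add: DERIV_def power2_eq_square)
next
  case False
  show ?thesis
  proof (cases "s > 0")
    case True
    have "((\<lambda>s. s\<^sup>2) has_real_derivative 2 * s) (at s)"
      by (auto intro!: derivative_eq_intros)
    then have "((\<lambda>s. (max 0 s)\<^sup>2) has_real_derivative 2 * s) (at s)"
      by (rule has_field_derivative_transform_within_open[where S = "{0<..}"]) (use True in auto)
    then show ?thesis using True by simp
  next
    case nonpos: False
    have "((\<lambda>s. 0) has_real_derivative 0) (at s)" by simp
    then have "((\<lambda>s. (max 0 s)\<^sup>2) has_real_derivative 0) (at s)"
      by (rule has_field_derivative_transform_within_open[where S = "{..<0}"]) (use False nonpos in auto)
    then show ?thesis using nonpos by simp
  qed
qed

lemma has_real_derivative_cutoff: "e > 0 \<Longrightarrow> (cutoff e has_real_derivative cutoff' e s) (at s)"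
proof -
  assume e: "e > 0"
  have "((\<lambda>s. (max 0 (s - c))\<^sup>2) has_real_derivative 2 * max 0 (s - c)) (at s)" for c :: real
    using DERIV_shift[of "\<lambda>s. (max 0 s)\<^sup>2" "2 * max 0 (s - c)" s "- c"]
      has_real_derivative_max_0_power2[of "s - c"] by simp
  then have "((\<lambda>s. ((max 0 (s - e))\<^sup>2 - (max 0 (s - 2 * e))\<^sup>2) / (2 * e)) has_real_derivative
      (2 * max 0 (s - e) - 2 * max 0 (s - 2 * e)) / (2 * e)) (at s)"
    by (intro DERIV_cdivide DERIV_diff) auto
  moreover have "(2 * max 0 (s - e) - 2 * max 0 (s - 2 * e)) / (2 * e) = cutoff' e s"
    using e by (simp add: cutoff'_def field_simps)
  ultimately show ?thesis by (simp add: cutoff_def[abs_def])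
qed

lemma continuous_on_cutoff': "continuous_on S (cutoff' e)"
  unfolding cutoff'_def[abs_def] divide_inverse by (intro continuous_intros)

lemma cutoff'_bounds: "e > 0 \<Longrightarrow> 0 \<le> cutoff' e s" "e > 0 \<Longrightarrow> cutoff' e s \<le> 1"
  by (auto simp: cutoff'_def max_def field_simps)

lemma cutoff_eq_0: "e > 0 \<Longrightarrow> s \<le> e \<Longrightarrow> cutoff e s = 0" "e > 0 \<Longrightarrow> s \<le> e \<Longrightarrow> cutoff' e s = 0"
  by (auto simp: cutoff_def cutoff'_def max_def)

lemma cutoff'_eq_1: "e > 0 \<Longrightarrow> 2 * e \<le> s \<Longrightarrow> cutoff' e s = 1"
  by (auto simp: cutoff'_def max_def field_simps)

text \<open>This is the lower half of the estimate that makes truncation harmless: it costs at most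
  2 e pointwise. The upper half is in \<open>cutoff_bounds\<close>.\<close>

lemma cutoff_ge: "e > 0 \<Longrightarrow> s - 2 * e \<le> cutoff e s"
proof -
  assume e: "e > 0"
  consider "s \<le> e" | "e < s" "s \<le> 2 * e" | "2 * e < s" by linarith
  then show ?thesis
  proof cases
    case 2
    then have "0 \<le> (s - e)\<^sup>2 / (2 * e)" using e by simp
    moreover have "cutoff e s = (s - e)\<^sup>2 / (2 * e)" using 2 by (simp add: cutoff_def)
    ultimately show ?thesis using 2 by linarith
  next
    case 3
    then have "cutoff e s = s - 3 / 2 * e"
      using e by (simp add: cutoff_def power2_eq_square field_simps)
    then show ?thesis using e by simp
  qed (use e in \<open>auto simp: cutoff_eq_0\<close>)
qed

lemma cutoff_bounds:
  assumes "e > 0"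
  shows "0 \<le> cutoff e s" and "0 \<le> s \<Longrightarrow> cutoff e s \<le> s"
proof -
  consider "s \<le> e" | "e < s" "s \<le> 2 * e" | "2 * e < s" by linarith
  then have "0 \<le> cutoff e s \<and> (0 \<le> s \<longrightarrow> cutoff e s \<le> s)"
  proof cases
    case 2
    then have "(s - e) * (s - e) \<le> e * e" using assms by (intro mult_mono) auto
    also have "\<dots> \<le> s * (2 * e)" using assms 2 by (intro mult_mono) auto
    finally have "(s - e)\<^sup>2 / (2 * e) \<le> s"
      using assms by (simp add: power2_eq_square divide_le_eq)
    then show ?thesis using 2 assms by (simp add: cutoff_def)
  next
    case 3
    then have "cutoff e s = s - 3 / 2 * e"
      using assms by (simp add: cutoff_def power2_eq_square field_simps)
    then show ?thesis using 3 assms by simp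
  qed (use assms in \<open>auto simp: cutoff_eq_0\<close>)
  then show "0 \<le> cutoff e s" "0 \<le> s \<Longrightarrow> cutoff e s \<le> s" by auto
qed

lemma Ck_on_1_compose:
  assumes f: "Ck_on 1 U f" and d: "\<And>s. (\<phi> has_real_derivative \<phi>' s) (at s)" and c: "continuous_on UNIV \<phi>'"
  shows "Ck_on 1 U (\<lambda>p. \<phi> (f p))"
proof (rule Ck_on_1_I)
  note df = Ck_on_1_D[OF f]
  show "(\<lambda>p. \<phi> (f p)) differentiable (at p)" if "p \<in> U" for p
    using differentiable_compose[of \<phi> f p UNIV] df(1)[OF that] d
    by (meson differentiableI real_differentiable_def)
  fix i
  have "continuous_on U (\<lambda>p. \<phi>' (f p) * partial i f p)"
    by (intro continuous_intros df continuous_on_compose2[OF c]) auto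
  then show "continuous_on U (partial i (\<lambda>p. \<phi> (f p)))"
    by (rule continuous_on_eq) (simp add: partial_compose[OF df(1) d])
qed

lemma grad_compose:
  assumes "f differentiable (at p)" "(\<phi> has_real_derivative c) (at (f p))"
  shows "grad (\<lambda>q. \<phi> (f q)) p = c *\<^sub>R grad f p"
  by (simp add: vec_eq_iff partial_compose[OF assms])

text \<open>Expand the form at \<open>c *\<^sub>R x - y\<close>, where it is nonnegative, and divide
  by c.\<close>

lemma quadratic_form_AM_GM:
  fixes L :: "real^'n^'n" and x y :: "real^'n"
  assumes sym: "\<And>x y. (L *v x) \<bullet> y = (L *v y) \<bullet> x" and psd: "\<And>x. 0 \<le> (L *v x) \<bullet> x" and "c > 0"
  shows "2 * ((L *v x) \<bullet> y) \<le> c * ((L *v x) \<bullet> x) + ((L *v y) \<bullet> y) / c"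
proof -
  have "0 \<le> (L *v (c *\<^sub>R x - y)) \<bullet> (c *\<^sub>R x - y)" by (rule psd)
  also have "\<dots> = c * (c * ((L *v x) \<bullet> x) + ((L *v y) \<bullet> y) / c - 2 * ((L *v x) \<bullet> y))"
    using sym[of y x] \<open>c > 0\<close>
    by (simp add: matrix_vector_mult_diff_distrib matrix_vector_mult_scaleR inner_diff_left
        inner_diff_right field_simps)
  finally show ?thesis using \<open>c > 0\<close> by (simp add: zero_le_mult_iff)
qed

lemma Ck_on_2_imp_1: "Ck_on 2 U f \<Longrightarrow> Ck_on 1 U f"
  using Ck_on_2_D[of U f] Ck_on_1_D(3) by (intro Ck_on_1_I) blast+

text \<open>The density of a left invariant metric is constant in the chart, so its torsion equation
  has this flat divergence form with M the cometric. Working with a general M keeps the comparison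
  independent of the group.\<close>

locale torsion_problem =
  fixes U :: "(real^'n) set" and M :: "real^'n \<Rightarrow> real^'n^'n" and u :: "real^'n \<Rightarrow> real"
  assumes open_U: "open U" and bounded_U: "bounded U"
    and M_C1: "Ck_on 1 U (\<lambda>p. M p $ i $ j)"
    and M_sym: "p \<in> U \<Longrightarrow> (M p *v x) \<bullet> y = (M p *v y) \<bullet> x"
    and M_psd: "p \<in> U \<Longrightarrow> 0 \<le> (M p *v x) \<bullet> x"
    and u_C2: "Ck_on 2 U u" and u_cont: "continuous_on (closure U) u"
    and u_frontier: "p \<in> frontier U \<Longrightarrow> u p = 0"
    and u_eq: "p \<in> U \<Longrightarrow> divergence (\<lambda>q. M q *v grad u q) p = - 1"
begin

lemma u_C1: "Ck_on 1 U u"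
  using u_C2 by (rule Ck_on_2_imp_1)

lemma flux_C1: "Ck_on 1 U (\<lambda>p. (M p *v grad u p) $ i)"
  unfolding matrix_vector_mult_def grad_nth vec_lambda_beta
  using Ck_on_1_mult[OF M_C1 Ck_on_2_D(2)[OF u_C2]] by (intro Ck_on_1_sum) auto

text \<open>Multiply the equation by - w and integrate by parts.\<close>

lemma weak_form:
  assumes K: "compact K" "K \<subseteq> U" and w: "Ck_on 1 U w" and w0: "\<And>p. p \<in> U - K \<Longrightarrow> w p = 0"
  shows "(LINT p:U|lborel. w p) = (LINT p:U|lborel. (M p *v grad u p) \<bullet> grad w p)"
proof -
  have "(LINT p:U|lborel. w p) = - (LINT p:U|lborel. w p * divergence (\<lambda>q. M q *v grad u q) p)"
    using u_eq by (auto simp: set_lebesgue_integral_def indicator_def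
        simp flip: Bochner_Integration.integral_minus intro!: Bochner_Integration.integral_cong)
  also have "\<dots> = (LINT p:U|lborel. (M p *v grad u p) \<bullet> grad w p)"
    using integral_by_parts[OF open_U K w w0 flux_C1] by simp
  finally show ?thesis .
qed

text \<open>On the frontier h (u p) = h 0 = 0 < e, so the corresponding subset of the compact
  closure stays inside U. The cases h = \<open>id\<close> and h = \<open>uminus\<close> serve
  positive and negative truncations.\<close>

lemma compact_superlevel:
  fixes h :: "real \<Rightarrow> real"
  assumes "e > 0" "continuous_on UNIV h" "h 0 = 0"
  shows "compact {p \<in> U. e \<le> h (u p)}"
proof -
  have "{p \<in> U. e \<le> h (u p)} = {p \<in> closure U. e \<le> h (u p)}"
  proof -
    have "p \<in> U" if p: "p \<in> closure U \<and> e \<le> h (u p)" for p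
    proof (rule ccontr)
      assume "p \<notin> U"
      then have "p \<in> frontier U" using p open_U by (simp add: frontier_def interior_open)
      then show False using u_frontier[of p] assms p by auto
    qed
    then show ?thesis using closure_subset by auto
  qed
  moreover have "closed (closure U \<inter> (\<lambda>p. h (u p)) -` {e..})"
    by (rule continuous_closed_preimage)
      (auto intro: continuous_on_compose2[OF assms(2) u_cont])
  moreover have "closure U \<inter> (\<lambda>p. h (u p)) -` {e..} = {p \<in> closure U. e \<le> h (u p)}" by auto
  moreover have "bounded {p \<in> closure U. e \<le> h (u p)}"
    by (rule bounded_subset[OF bounded_closure[OF bounded_U]]) auto
  ultimately show ?thesis by (simp add: compact_eq_bounded_closed)
qed

lemma energy_cont: "continuous_on U (\<lambda>p. (M p *v grad u p) \<bullet> grad u p)"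
  unfolding inner_vec_def inner_real_def grad_nth
  by (intro continuous_intros Ck_on_1_D(3)[OF flux_C1] Ck_on_1_D(2)[OF u_C1])

lemma energy_cutoff:
  assumes "e > 0"
  shows "(LINT p:U|lborel. cutoff e (u p))
    = (LINT p:U|lborel. cutoff' e (u p) * ((M p *v grad u p) \<bullet> grad u p))"
proof -
  have "(LINT p:U|lborel. cutoff e (u p)) = (LINT p:U|lborel. (M p *v grad u p) \<bullet> grad (\<lambda>q. cutoff e (u q)) p)"
  proof (rule weak_form)
    show "compact {p \<in> U. e \<le> id (u p)}" by (rule compact_superlevel) (use assms in auto)
    show "Ck_on 1 U (\<lambda>q. cutoff e (u q))"
      using u_C1 has_real_derivative_cutoff[OF assms] continuous_on_cutoff' by (rule Ck_on_1_compose)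
  qed (use assms in \<open>auto simp: cutoff_eq_0\<close>)
  also have "\<dots> = (LINT p:U|lborel. cutoff' e (u p) * ((M p *v grad u p) \<bullet> grad u p))"
    by (rule set_lebesgue_integral_cong)
      (use open_U in \<open>auto simp: grad_compose[OF Ck_on_1_D(1)[OF u_C1] has_real_derivative_cutoff[OF assms]]\<close>)
  finally show ?thesis .
qed

text \<open>Weak maximum principle: tested with the truncation of - u, the equation makes the
  integral of a nonnegative function at most 0, although that function is positive near any point
  where u < 0.\<close>

lemma u_nonneg: assumes "p \<in> U" shows "0 \<le> u p"
proof (rule ccontr)
  assume neg: "\<not> 0 \<le> u p"
  \<comment> \<open>With this e, - u p = 3 e, and \<open>cutoff_ge\<close> makes the test function
    at least e at p.\<close>
  define e where "e = - u p / 3"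
  have e: "e > 0" using neg by (simp add: e_def)
  let ?w = "\<lambda>q. cutoff e (- u q)"
  let ?K = "{q \<in> U. e \<le> - u q}"
  have dm: "((\<lambda>s. cutoff e (- s)) has_real_derivative - cutoff' e (- s)) (at s)" for s
    using has_real_derivative_cutoff[OF e, of "- s"] by (simp add: DERIV_mirror)
  have K: "compact ?K" by (rule compact_superlevel[of e uminus]) (use e in \<open>auto intro!: continuous_intros\<close>)
  have w: "Ck_on 1 U ?w"
    using u_C1 dm by (rule Ck_on_1_compose)
      (auto intro!: continuous_intros continuous_on_compose2[OF continuous_on_cutoff'[of UNIV]])
  have w0: "?w q = 0" if "q \<in> U - ?K" for q using that e by (auto simp: cutoff_eq_0)
  have int: "set_integrable lborel U ?w"
    by (rule set_integrable_compact_support[OF open_U K _ Ck_on_1_D(3)[OF w]]) (use w0 in auto)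
  have "(LINT q:U|lborel. ?w q) = (LINT q:U|lborel. (M q *v grad u q) \<bullet> grad ?w q)"
    by (rule weak_form[OF K _ w]) (use w0 in auto)
  also have "\<dots> = (LINT q:U|lborel. - (cutoff' e (- u q) * ((M q *v grad u q) \<bullet> grad u q)))"
    by (rule set_lebesgue_integral_cong)
      (use open_U in \<open>auto simp: grad_compose[OF Ck_on_1_D(1)[OF u_C1] dm]\<close>)
  also have "\<dots> = - (LINT q:U|lborel. cutoff' e (- u q) * ((M q *v grad u q) \<bullet> grad u q))"
    by (simp add: set_lebesgue_integral_def)
  also have "\<dots> \<le> 0"
    unfolding set_lebesgue_integral_def neg_le_0_iff_le
    by (rule Bochner_Integration.integral_nonneg)
      (auto simp: indicator_def intro!: mult_nonneg_nonneg cutoff'_bounds e M_psd)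
  finally have le0: "(LINT q:U|lborel. ?w q) \<le> 0" .
  have "?w p > e / 2" using cutoff_ge[OF e, of "- u p"] e by (simp add: e_def)
  moreover have "open (?w -` {e / 2<..} \<inter> U)"
    using Ck_on_1_D(3)[OF w] open_U by (simp add: continuous_on_open_vimage)
  ultimately obtain r where r: "r > 0" "ball p r \<subseteq> ?w -` {e / 2<..} \<inter> U"
    using assms by (metis IntI greaterThan_iff open_contains_ball vimageI)
  have fin: "emeasure lborel (ball p r) < \<infinity>" by (rule emeasure_bounded_finite) simp
  have "0 < e / 2 * measure lborel (ball p r)"
    using e content_ball_pos[OF r(1), of p] by simp
  also have "\<dots> = (LINT q|lborel. indicator (ball p r) q *\<^sub>R (e / 2))"
    using fin by simp
  also have "\<dots> \<le> (LINT q:U|lborel. ?w q)"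
    unfolding set_lebesgue_integral_def
  proof (rule integral_mono)
    show "integrable lborel (\<lambda>q. indicator (ball p r) q *\<^sub>R (e / 2))"
      using fin by (intro integrable_scaleR_left integrable_real_indicator) auto
    show "indicator (ball p r) q *\<^sub>R (e / 2) \<le> indicator U q *\<^sub>R ?w q" for q
      using r(2) cutoff_bounds(1)[OF e] by (auto simp: indicator_def less_imp_le)
  qed (use int in \<open>simp add: set_integrable_def\<close>)
  finally show False using le0 by simp
qed

text \<open>An interior zero is a minimum because u >= 0. This handles the points where
  \<open>cutoff' e (u p)\<close> stays 0 instead of tending to 1.\<close>

lemma grad_eq_0: assumes "p \<in> U" "u p = 0" shows "grad u p = 0"
proof -
  have "(u has_derivative frechet_derivative u (at p)) (at p)"
    using Ck_on_1_D(1)[OF u_C1 assms(1)] frechet_derivative_works by blast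
  then have "frechet_derivative u (at p) = (\<lambda>v. 0)"
    by (rule differential_zero_maxmin[OF assms(1) open_U]) (use u_nonneg assms in auto)
  then show ?thesis by (simp add: vec_eq_iff partial_def)
qed

lemma set_integrable_u: "set_integrable lborel U u"
proof -
  have "set_integrable lborel (closure U) u"
    unfolding set_integrable_def
    by (rule borel_integrable_compact) (use bounded_U u_cont in auto)
  then show ?thesis
    by (rule set_integrable_subset) (use open_U closure_subset in auto)
qed

lemma set_integrable_energy_cutoff:
  assumes "e > 0"
  shows "set_integrable lborel U (\<lambda>p. cutoff' e (u p) * ((M p *v grad u p) \<bullet> grad u p))"
proof (rule set_integrable_compact_support[OF open_U])
  show "compact {p \<in> U. e \<le> id (u p)}" by (rule compact_superlevel) (use assms in auto)
  show "continuous_on U (\<lambda>p. cutoff' e (u p) * ((M p *v grad u p) \<bullet> grad u p))"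
    by (intro continuous_intros energy_cont continuous_on_compose2[OF continuous_on_cutoff' Ck_on_1_D(3)[OF u_C1]]) auto
qed (use assms in \<open>auto simp: cutoff_eq_0\<close>)

lemma set_integrable_cutoff:
  assumes "e > 0"
  shows "set_integrable lborel U (\<lambda>p. cutoff e (u p))"
proof (rule set_integrable_compact_support[OF open_U])
  show "compact {p \<in> U. e \<le> id (u p)}" by (rule compact_superlevel) (use assms in auto)
  show "continuous_on U (\<lambda>p. cutoff e (u p))"
    using Ck_on_1_D(3)[OF Ck_on_1_compose[OF u_C1 has_real_derivative_cutoff[OF assms] continuous_on_cutoff']] .
qed (use assms in \<open>auto simp: cutoff_eq_0\<close>)

lemma integral_cutoff_le:
  assumes "e > 0" shows "(LINT p:U|lborel. cutoff e (u p)) \<le> (LINT p:U|lborel. u p)"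
  by (rule set_integral_mono[OF set_integrable_cutoff set_integrable_u])
    (use assms cutoff_bounds u_nonneg in auto)

text \<open>On K the energy density is continuous, hence integrable, and dominates its products with
  \<open>cutoff'\<close>. These converge to it as e tends to 0, while \<open>energy_cutoff\<close>
  bounds each integral by that of \<open>cutoff e (u p)\<close>, hence by that of u.\<close>

lemma energy_compact_le:
  assumes K: "compact K" "K \<subseteq> U"
  shows "(LINT p:K|lborel. (M p *v grad u p) \<bullet> grad u p) \<le> (LINT p:U|lborel. u p)"
proof -
  let ?en = "\<lambda>p. (M p *v grad u p) \<bullet> grad u p"
  let ?e = "\<lambda>n. 1 / real (Suc n)"
  have enK: "set_integrable lborel K ?en"
    unfolding set_integrable_def
    by (rule borel_integrable_compact[OF K(1)]) (use energy_cont K(2) continuous_on_subset in blast)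
  have Kb: "K \<in> sets lborel" using K by (simp add: borel_compact)
  have "(\<lambda>n. LINT p:K|lborel. cutoff' (?e n) (u p) * ?en p) \<longlonglongrightarrow> (LINT p:K|lborel. ?en p)"
    unfolding set_lebesgue_integral_def
  proof (rule integral_dominated_convergence[where w = "\<lambda>p. indicator K p *\<^sub>R ?en p"])
    show "integrable lborel (\<lambda>p. indicator K p *\<^sub>R ?en p)"
      using enK by (simp add: set_integrable_def)
    then show "(\<lambda>p. indicator K p *\<^sub>R ?en p) \<in> borel_measurable lborel" by simp
    show "(\<lambda>p. indicator K p *\<^sub>R (cutoff' (?e n) (u p) * ?en p)) \<in> borel_measurable lborel" for n
    proof -
      have "set_integrable lborel K (\<lambda>p. cutoff' (?e n) (u p) * ?en p)"
        by (rule set_integrable_subset[OF set_integrable_energy_cutoff Kb K(2)]) simp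
      then show ?thesis unfolding set_integrable_def by simp
    qed
    show "AE p in lborel. (\<lambda>n. indicator K p *\<^sub>R (cutoff' (?e n) (u p) * ?en p)) \<longlonglongrightarrow> indicator K p *\<^sub>R ?en p"
    proof (rule AE_I2)
      fix p :: "real^'n"
      show "(\<lambda>n. indicator K p *\<^sub>R (cutoff' (?e n) (u p) * ?en p)) \<longlonglongrightarrow> indicator K p *\<^sub>R ?en p"
      proof (cases "p \<in> K \<and> u p \<noteq> 0")
        case True
        then have pos: "u p > 0" using u_nonneg[of p] K(2) by force
        have "(\<lambda>n. 2 * ?e n) \<longlonglongrightarrow> 2 * 0"
          using LIMSEQ_inverse_real_of_nat by (intro tendsto_mult tendsto_const) (simp add: inverse_eq_divide)
        then have "\<forall>\<^sub>F n in sequentially. 2 * ?e n < u p"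
          using pos by (intro order_tendstoD) auto
        then have "\<forall>\<^sub>F n in sequentially. cutoff' (?e n) (u p) = 1"
          by eventually_elim (rule cutoff'_eq_1, auto)
        then have "\<forall>\<^sub>F n in sequentially. indicator K p *\<^sub>R (cutoff' (?e n) (u p) * ?en p) = indicator K p *\<^sub>R ?en p"
          by eventually_elim simp
        then show ?thesis by (rule tendsto_eventually)
      next
        case False
        then have "p \<notin> K \<or> grad u p = 0" using grad_eq_0 K(2) by blast
        then show ?thesis by auto
      qed
    qed
    show "AE p in lborel. norm (indicator K p *\<^sub>R (cutoff' (?e n) (u p) * ?en p)) \<le> indicator K p *\<^sub>R ?en p" for n
    proof (rule AE_I2)
      fix p :: "real^'n"
      have "cutoff' (?e n) (u p) * ?en p \<le> 1 * ?en p" if "p \<in> K"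
        by (rule mult_right_mono) (use cutoff'_bounds M_psd that K in auto)
      moreover have "0 \<le> cutoff' (?e n) (u p) * ?en p" if "p \<in> K"
        using cutoff'_bounds M_psd that K by (intro mult_nonneg_nonneg) auto
      ultimately show "norm (indicator K p *\<^sub>R (cutoff' (?e n) (u p) * ?en p)) \<le> indicator K p *\<^sub>R ?en p"
        by (cases "p \<in> K") auto
    qed
  qed
  moreover have "(LINT p:K|lborel. cutoff' (?e n) (u p) * ?en p) \<le> (LINT p:U|lborel. u p)" for n
  proof -
    have "(LINT p:K|lborel. cutoff' (?e n) (u p) * ?en p) \<le> (LINT p:U|lborel. cutoff' (?e n) (u p) * ?en p)"
      unfolding set_lebesgue_integral_def
    proof (rule integral_mono)
      show i: "integrable lborel (\<lambda>p. indicator U p *\<^sub>R (cutoff' (?e n) (u p) * ?en p))"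
        using set_integrable_energy_cutoff[of "?e n"] by (simp add: set_integrable_def)
      show "integrable lborel (\<lambda>p. indicator K p *\<^sub>R (cutoff' (?e n) (u p) * ?en p))"
        by (rule set_integrable_subset[OF _ Kb K(2), unfolded set_integrable_def, OF i])
    qed (use cutoff'_bounds M_psd K in \<open>auto simp: indicator_def\<close>)
    also have "\<dots> = (LINT p:U|lborel. cutoff (?e n) (u p))"
      by (rule energy_cutoff[symmetric]) simp
    also have "\<dots> \<le> (LINT p:U|lborel. u p)" by (rule integral_cutoff_le) simp
    finally show ?thesis .
  qed
  ultimately show ?thesis by (intro LIMSEQ_le_const2) auto
qed

end

text \<open>The equation of v is tested with the truncation of u. The mixed energy splits by
  \<open>quadratic_form_AM_GM\<close> into one of v and one of u, and L <= c K turns the latter into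
  a term absorbed on the left. With K = L and c = 1 the result also shows that the integral is the
  same for all solutions.\<close>

theorem torsion_comparison:
  assumes "torsion_problem U K u" "torsion_problem U L v" and c: "c > 0"
    and le: "\<And>p x. p \<in> U \<Longrightarrow> (L p *v x) \<bullet> x \<le> c * ((K p *v x) \<bullet> x)"
  shows "(LINT p:U|lborel. u p) \<le> c * (LINT p:U|lborel. v p)"
proof -
  interpret u: torsion_problem U K u by fact
  interpret v: torsion_problem U L v by fact
  let ?I = "LINT p:U|lborel. v p"
  have main: "(LINT p:U|lborel. cutoff e (u p)) \<le> c * ?I" if e: "e > 0" for e
  proof -
    let ?J = "LINT p:U|lborel. cutoff e (u p)"
    let ?w = "\<lambda>p. cutoff e (u p)"
    let ?S = "{p \<in> U. e \<le> id (u p)}"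
    let ?enu = "\<lambda>p. (K p *v grad u p) \<bullet> grad u p" and ?env = "\<lambda>p. (L p *v grad v p) \<bullet> grad v p"
    have S: "compact ?S" "?S \<subseteq> U" using u.compact_superlevel[OF e, of id] by auto
    have w: "Ck_on 1 U ?w"
      using u.u_C1 has_real_derivative_cutoff[OF e] continuous_on_cutoff' by (rule Ck_on_1_compose)
    have gw: "grad ?w p = cutoff' e (u p) *\<^sub>R grad u p" if "p \<in> U" for p
      by (rule grad_compose[OF Ck_on_1_D(1)[OF u.u_C1 that] has_real_derivative_cutoff[OF e]])
    have gw0: "grad ?w p = 0" if "p \<in> U - ?S" for p
      using that cutoff_eq_0(2)[OF e, of "u p"] gw[of p] by auto
    have int_env: "set_integrable lborel ?S ?env"
      unfolding set_integrable_def
      by (rule borel_integrable_compact[OF S(1)]) (use v.energy_cont S(2) continuous_on_subset in blast)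
    moreover have "(\<lambda>p. indicator U p *\<^sub>R (indicator ?S p * ?env p)) = (\<lambda>p. indicator ?S p *\<^sub>R ?env p)"
      by (auto simp: fun_eq_iff indicator_def)
    ultimately have int_env': "set_integrable lborel U (\<lambda>p. indicator ?S p * ?env p)"
      by (simp add: set_integrable_def)
    have Jv: "?J = (LINT p:U|lborel. (L p *v grad v p) \<bullet> grad ?w p)"
      by (rule v.weak_form[OF S w]) (use e in \<open>auto simp: cutoff_eq_0\<close>)
    \<comment> \<open>The indicator confines the energy of v to the compact set \<open>?S\<close>,
      off which the gradient of the test function vanishes.\<close>
    have pw: "2 * ((L p *v grad v p) \<bullet> grad ?w p)
        \<le> c * (indicator ?S p * ?env p) + cutoff' e (u p) * ?enu p" if p: "p \<in> U" for p
    proof (cases "p \<in> ?S")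
      case True
      let ?a = "cutoff' e (u p)"
      have "2 * ((L p *v grad v p) \<bullet> grad ?w p) \<le> c * ?env p + ((L p *v grad ?w p) \<bullet> grad ?w p) / c"
        using v.M_sym[OF p] v.M_psd[OF p] c by (rule quadratic_form_AM_GM)
      also have "((L p *v grad ?w p) \<bullet> grad ?w p) / c = ?a\<^sup>2 * ((L p *v grad u p) \<bullet> grad u p) / c"
        by (simp add: gw[OF p] matrix_vector_mult_scaleR power2_eq_square)
      also have "\<dots> \<le> ?a\<^sup>2 * (c * ?enu p) / c"
        using c le[OF p] by (intro divide_right_mono mult_left_mono) auto
      also have "\<dots> = ?a\<^sup>2 * ?enu p" using c by simp
      \<comment> \<open>Since 0 <= ?a <= 1, its square is at most ?a. This recovers the integrand of
        \<open>u.energy_cutoff\<close>, whose integral is \<open>?J\<close> again.\<close>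
      also have "\<dots> \<le> ?a * ?enu p"
        using cutoff'_bounds[OF e] u.M_psd[OF p]
        by (intro mult_right_mono) (auto simp: power2_eq_square mult_left_le)
      finally show ?thesis using True by simp
    next
      case False
      then show ?thesis using gw0[of p] p cutoff_eq_0[OF e, of "u p"] by auto
    qed
    have iw: "set_integrable lborel U (\<lambda>p. (L p *v grad v p) \<bullet> grad ?w p)"
    proof (rule set_integrable_compact_support[OF v.open_U S])
      show "continuous_on U (\<lambda>p. (L p *v grad v p) \<bullet> grad ?w p)"
        unfolding inner_vec_def inner_real_def grad_nth
        by (intro continuous_intros Ck_on_1_D(3)[OF v.flux_C1] Ck_on_1_D(2)[OF w])
    qed (use gw0 in simp)
    note iu = u.set_integrable_energy_cutoff[OF e]
    have "2 * ?J = (LINT p:U|lborel. 2 * ((L p *v grad v p) \<bullet> grad ?w p))"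
      by (simp add: Jv)
    also have "\<dots> \<le> (LINT p:U|lborel. c * (indicator ?S p * ?env p) + cutoff' e (u p) * ?enu p)"
      by (rule set_integral_mono) (use iw int_env' iu pw in auto)
    also have "\<dots> = c * (LINT p:U|lborel. indicator ?S p * ?env p)
        + (LINT p:U|lborel. cutoff' e (u p) * ?enu p)"
      using int_env' iu by (subst set_integral_add) auto
    also have "(LINT p:U|lborel. indicator ?S p * ?env p) = (LINT p:?S|lborel. ?env p)"
      unfolding set_lebesgue_integral_def using S(2)
      by (intro Bochner_Integration.integral_cong) (auto simp: indicator_def)
    also have "(LINT p:U|lborel. cutoff' e (u p) * ?enu p) = ?J"
      by (rule u.energy_cutoff[OF e, symmetric])
    finally have "?J \<le> c * (LINT p:?S|lborel. ?env p)" by simp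
    also have "\<dots> \<le> c * ?I"
      using v.energy_compact_le[OF S] c by simp
    finally show ?thesis .
  qed
  have fin: "emeasure lborel U < \<infinity>" using u.bounded_U emeasure_bounded_finite by auto
  have const: "set_integrable lborel U (\<lambda>_. d)" for d :: real
    unfolding set_integrable_def using fin u.open_U by (intro integrable_scaleR_left integrable_real_indicator) auto
  have "(LINT p:U|lborel. u p) \<le> c * ?I + 2 * e * measure lborel U" if e: "e > 0" for e
  proof -
    have "(LINT p:U|lborel. u p) \<le> (LINT p:U|lborel. cutoff e (u p) + 2 * e)"
      by (rule set_integral_mono[OF u.set_integrable_u])
        (use u.set_integrable_cutoff[OF e] const cutoff_ge[OF e] in \<open>auto simp: algebra_simps\<close>)
    also have "\<dots> = (LINT p:U|lborel. cutoff e (u p)) + 2 * e * measure lborel U"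
      using u.set_integrable_cutoff[OF e] const u.open_U fin
      by (subst set_integral_add) (auto simp: set_integral_const)
    finally show ?thesis using main[OF e] by simp
  qed
  note eps = this
  show ?thesis
  proof (rule field_le_epsilon)
    fix d :: real assume d: "d > 0"
    let ?m = "measure lborel U"
    \<comment> \<open>The added 1 keeps the denominator positive when U has measure 0.\<close>
    have "2 * (d / (2 * (?m + 1))) * ?m \<le> d"
      using d by (simp add: divide_le_eq mult_left_mono add_nonneg_pos)
    then show "(LINT p:U|lborel. u p) \<le> c * ?I + d"
      using eps[of "d / (2 * (?m + 1))"] d by (simp add: add_nonneg_pos)
  qed
qed

section \<open>The Ricci tensor of a left invariant metric\<close>

lemma matrix_inv_eqI:
  fixes A :: "real^'n^'n"
  assumes "A ** B = mat 1"
  shows "matrix_inv A = B"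
proof -
  have BA: "B ** A = mat 1" using assms by (simp add: matrix_left_right_inverse)
  then have inv: "A ** matrix_inv A = mat 1 \<and> matrix_inv A ** A = mat 1"
    unfolding matrix_inv_def using assms by (intro someI_ex[of "\<lambda>A'. A ** A' = mat 1 \<and> A' ** A = mat 1"]) blast
  have "matrix_inv A = B ** (A ** matrix_inv A)"
    by (simp add: matrix_mul_assoc BA)
  then show ?thesis using inv by simp
qed

text \<open>The metric \<open>a \<eta>\<otimes>\<eta> + h\<close> with \<open>\<eta> = dz - \<alpha> dx - (\<beta> + x) dy\<close> and a constant form \<open>h\<close> in \<open>dx\<close>, \<open>dy\<close>; every
  left invariant metric has this shape, and all its tensors are polynomial in \<open>\<beta> + x\<close>.
  Below, \<open>(k\<^sub>i\<^sub>j)\<close> is the inverse of \<open>(h\<^sub>i\<^sub>j)\<close>.\<close>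

definition heis_metric :: "real \<Rightarrow> real \<Rightarrow> real \<Rightarrow> real \<Rightarrow> real \<Rightarrow> real \<Rightarrow> 3 metric" where
  "heis_metric a \<alpha> \<beta> h11 h12 h22 p u v =
     a * ((u$3 - \<alpha> * u$1 - (\<beta> + p$1) * u$2) * (v$3 - \<alpha> * v$1 - (\<beta> + p$1) * v$2))
     + h11 * (u$1 * v$1) + h12 * (u$1 * v$2 + u$2 * v$1) + h22 * (u$2 * v$2)"

definition quad :: "real \<Rightarrow> real \<Rightarrow> real \<Rightarrow> real \<Rightarrow> real^3 \<Rightarrow> real" where
  "quad \<beta> c0 c1 c2 p = c0 + c1 * (\<beta> + p$1) + c2 * (\<beta> + p$1)\<^sup>2"

lemma has_derivative_quad:
  "(quad \<beta> c0 c1 c2 has_derivative (\<lambda>h. c1 * h$1 + c2 * (2 * h$1 * (\<beta> + p$1)))) (at p)"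
proof -
  have "((\<lambda>p. p $ 1) has_derivative (\<lambda>h::real^3. h $ 1)) (at p)"
    by (rule bounded_linear.has_derivative[OF bounded_linear_vec_nth has_derivative_ident])
  then show ?thesis
    unfolding quad_def[abs_def] by (auto intro!: derivative_eq_intros)
qed

lemma partial_quad: "partial i (quad \<beta> c0 c1 c2) p = (if i = 1 then c1 + 2 * c2 * (\<beta> + p$1) else 0)"
  using partial_eqI[OF has_derivative_quad] by (simp add: axis_def)

text \<open>The inverse enters through polynomial equations instead of a division by the
  determinant, so 1 / a is the only quotient in the cometric.\<close>

locale heis_coeffs =
  fixes a \<alpha> \<beta> h11 h12 h22 k11 k12 k22 :: real
  assumes a: "a \<noteq> 0"
    and hk: "h11 * k11 + h12 * k12 = 1" "h11 * k12 + h12 * k22 = 0"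
      "h12 * k11 + h22 * k12 = 0" "h12 * k12 + h22 * k22 = 1"
begin

abbreviation "G \<equiv> heis_metric a \<alpha> \<beta> h11 h12 h22"
abbreviation "Q \<equiv> quad \<beta>"

text \<open>Equalities of functions rather than of values at p, so that \<open>partial_quad\<close>
  applies under a derivative. \<open>christoffel_quad\<close> has this form for the same
  reason.\<close>

lemma gram_quad:
  "(\<lambda>p. gram G p $ 1 $ 1) = Q (h11 + a * \<alpha>\<^sup>2) 0 0" "(\<lambda>p. gram G p $ 1 $ 2) = Q h12 (a * \<alpha>) 0"
  "(\<lambda>p. gram G p $ 1 $ 3) = Q (- a * \<alpha>) 0 0" "(\<lambda>p. gram G p $ 2 $ 1) = Q h12 (a * \<alpha>) 0"
  "(\<lambda>p. gram G p $ 2 $ 2) = Q h22 0 a" "(\<lambda>p. gram G p $ 2 $ 3) = Q 0 (- a) 0"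
  "(\<lambda>p. gram G p $ 3 $ 1) = Q (- a * \<alpha>) 0 0" "(\<lambda>p. gram G p $ 3 $ 2) = Q 0 (- a) 0"
  "(\<lambda>p. gram G p $ 3 $ 3) = Q a 0 0"
  by (simp_all add: fun_eq_iff gram_def heis_metric_def quad_def axis_def power2_eq_square algebra_simps)

lemma gram_entry: "gram G p = vector [vector [h11 + a * \<alpha>\<^sup>2, h12 + a * \<alpha> * (\<beta> + p$1), - a * \<alpha>],
    vector [h12 + a * \<alpha> * (\<beta> + p$1), h22 + a * (\<beta> + p$1)\<^sup>2, - a * (\<beta> + p$1)],
    vector [- a * \<alpha>, - a * (\<beta> + p$1), a]]"
  by (simp add: vec_eq_iff forall_3 gram_def heis_metric_def axis_def power2_eq_square algebra_simps)

lemma det_gram: "det (gram G p) = a * (h11 * h22 - h12\<^sup>2)"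
  by (simp add: gram_entry det_3 power2_eq_square algebra_simps)

lemma cogram_entry: "cogram G p = vector [vector [k11, k12, \<alpha> * k11 + (\<beta> + p$1) * k12],
    vector [k12, k22, \<alpha> * k12 + (\<beta> + p$1) * k22],
    vector [\<alpha> * k11 + (\<beta> + p$1) * k12, \<alpha> * k12 + (\<beta> + p$1) * k22,
      \<alpha> * (\<alpha> * k11 + (\<beta> + p$1) * k12) + (\<beta> + p$1) * (\<alpha> * k12 + (\<beta> + p$1) * k22) + 1 / a]]"
  unfolding cogram_def
proof (rule matrix_inv_eqI)
  \<comment> \<open>With w and b as atoms, every entry of the product is a ring identity modulo
    \<open>hk\<close> and a b = 1.\<close>
  define w b where "w = \<beta> + p$1" and "b = 1 / a"
  have ab: "a * b = 1" using a by (simp add: b_def)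
  show "gram G p ** vector [vector [k11, k12, \<alpha> * k11 + (\<beta> + p$1) * k12],
    vector [k12, k22, \<alpha> * k12 + (\<beta> + p$1) * k22],
    vector [\<alpha> * k11 + (\<beta> + p$1) * k12, \<alpha> * k12 + (\<beta> + p$1) * k22,
      \<alpha> * (\<alpha> * k11 + (\<beta> + p$1) * k12) + (\<beta> + p$1) * (\<alpha> * k12 + (\<beta> + p$1) * k22) + 1 / a]] = mat 1"
    unfolding gram_entry w_def[symmetric] b_def[symmetric]
    by (simp add: vec_eq_iff forall_3 matrix_matrix_mult_def sum_3 mat_def)
      (intro conjI; (use hk ab in algebra | simp add: algebra_simps))
qed

lemma christoffel_quad:
  "christoffel G 1 1 1 = Q (k12 * a * \<alpha>) 0 0"
  "christoffel G 1 1 2 = Q (- k11 * a * \<alpha> / 2) (k12 * a / 2) 0"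
  "christoffel G 1 1 3 = Q (- k12 * a / 2) 0 0"
  "christoffel G 1 2 1 = Q (- k11 * a * \<alpha> / 2) (k12 * a / 2) 0"
  "christoffel G 1 2 2 = Q 0 (- k11 * a) 0"
  "christoffel G 1 2 3 = Q (k11 * a / 2) 0 0"
  "christoffel G 1 3 1 = Q (- k12 * a / 2) 0 0"
  "christoffel G 1 3 2 = Q (k11 * a / 2) 0 0"
  "christoffel G 1 3 3 = Q 0 0 0"
  "christoffel G 2 1 1 = Q (k22 * a * \<alpha>) 0 0"
  "christoffel G 2 1 2 = Q (- k12 * a * \<alpha> / 2) (k22 * a / 2) 0"
  "christoffel G 2 1 3 = Q (- k22 * a / 2) 0 0"
  "christoffel G 2 2 1 = Q (- k12 * a * \<alpha> / 2) (k22 * a / 2) 0"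
  "christoffel G 2 2 2 = Q 0 (- k12 * a) 0"
  "christoffel G 2 2 3 = Q (k12 * a / 2) 0 0"
  "christoffel G 2 3 1 = Q (- k22 * a / 2) 0 0"
  "christoffel G 2 3 2 = Q (k12 * a / 2) 0 0"
  "christoffel G 2 3 3 = Q 0 0 0"
  "christoffel G 3 1 1 = Q (k12 * a * \<alpha>\<^sup>2) (k22 * a * \<alpha>) 0"
  "christoffel G 3 1 2 = Q (- k11 * a * \<alpha>\<^sup>2 / 2 - 1 / 2) 0 (k22 * a / 2)"
  "christoffel G 3 1 3 = Q (- k12 * a * \<alpha> / 2) (- k22 * a / 2) 0"
  "christoffel G 3 2 1 = Q (- k11 * a * \<alpha>\<^sup>2 / 2 - 1 / 2) 0 (k22 * a / 2)"
  "christoffel G 3 2 2 = Q 0 (- k11 * a * \<alpha>) (- k12 * a)"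
  "christoffel G 3 2 3 = Q (k11 * a * \<alpha> / 2) (k12 * a / 2) 0"
  "christoffel G 3 3 1 = Q (- k12 * a * \<alpha> / 2) (- k22 * a / 2) 0"
  "christoffel G 3 3 2 = Q (k11 * a * \<alpha> / 2) (k12 * a / 2) 0"
  "christoffel G 3 3 3 = Q 0 0 0"
  using a by (simp_all add: fun_eq_iff christoffel_def cogram_entry gram_quad partial_quad sum_3
      quad_def power2_eq_square field_simps)

text \<open>The form subtracted at the end is the adjugate of (k_ij), which is det k times h. The
  Ricci tensor is thus (a / 2) det k times the difference of the central part of the metric and its
  horizontal part h.\<close>

lemma ricci_heis:
  "ricci G p u v = a / 2 * (a * (k11 * k22 - k12\<^sup>2) *
      ((u$3 - \<alpha> * u$1 - (\<beta> + p$1) * u$2) * (v$3 - \<alpha> * v$1 - (\<beta> + p$1) * v$2))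
     - (k22 * (u$1 * v$1) - k12 * (u$1 * v$2 + u$2 * v$1) + k11 * (u$2 * v$2)))"
proof -
  define w where "w = \<beta> + p$1"
  show ?thesis
    unfolding ricci_def ricci_coeff_def sum_3 christoffel_quad partial_quad
    unfolding quad_def w_def[symmetric]
    by (simp add: power2_eq_square field_simps)
qed

end

section \<open>Milnor frames\<close>

lemma nil_mult_eq: "nil_mult p q = vector [p$1 + q$1, p$2 + q$2, p$3 + q$3 + p$1 * q$2]"
  by (simp add: nil_mult_def nil_coords_def nil_mat_def matrix_matrix_mult_def sum_3
      vec_eq_iff forall_3)

lemma vector_3_eq_axis_sum: "vector [a, b, c] = a *\<^sub>R axis 1 1 + b *\<^sub>R axis 2 1 + c *\<^sub>R (axis 3 1 :: real^3)"
  by (simp add: vec_eq_iff forall_3 axis_def)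

lemma has_derivative_nil_mult:
  "(nil_mult p has_derivative (\<lambda>h. vector [h$1, h$2, h$3 + p$1 * h$2])) (at q)"
  unfolding nil_mult_eq[abs_def] vector_3_eq_axis_sum
  by (auto intro!: derivative_eq_intros bounded_linear.has_derivative[OF bounded_linear_vec_nth])

text \<open>The origin is the identity of the group, so V p is the derivative of left translation by
  p applied to V 0.\<close>

lemma left_invariant_eq:
  assumes "left_invariant V"
  shows "V p = vector [V 0 $ 1, V 0 $ 2, V 0 $ 3 + p$1 * V 0 $ 2]"
proof -
  have "nil_mult p 0 = p" by (simp add: nil_mult_eq vec_eq_iff forall_3)
  then show ?thesis
    using assms frechet_derivative_at[OF has_derivative_nil_mult[of p 0]]
    unfolding left_invariant_def by (metis (no_types, lifting))
qed

text \<open>Left invariant fields are affine in the chart, and only their third component varies,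
  along x.\<close>

lemma lie_bracket_left_invariant:
  assumes "left_invariant V" "left_invariant W"
  shows "lie_bracket V W p = vector [0, 0, V 0 $ 1 * W 0 $ 2 - W 0 $ 1 * V 0 $ 2]"
proof -
  have D: "frechet_derivative X (at p) = (\<lambda>h. h$1 *\<^sub>R vector [0, 0, X 0 $ 2])" if "left_invariant X" for X
  proof -
    have "((\<lambda>p. X 0 + p$1 *\<^sub>R vector [0, 0, X 0 $ 2]) has_derivative (\<lambda>h. h$1 *\<^sub>R vector [0, 0, X 0 $ 2])) (at p)"
      by (auto intro!: derivative_eq_intros bounded_linear.has_derivative[OF bounded_linear_vec_nth])
    moreover have "X q = X 0 + q$1 *\<^sub>R vector [0, 0, X 0 $ 2]" for q
      by (subst left_invariant_eq[OF that, of q]) (simp add: vec_eq_iff forall_3)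
    then have "X = (\<lambda>q. X 0 + q$1 *\<^sub>R vector [0, 0, X 0 $ 2])" by blast
    ultimately show ?thesis using frechet_derivative_at[of X _ p] by metis
  qed
  have "V p $ 1 = V 0 $ 1" "W p $ 1 = W 0 $ 1"
    using arg_cong[OF left_invariant_eq[OF assms(1), of p], of "\<lambda>v. v $ 1"]
      arg_cong[OF left_invariant_eq[OF assms(2), of p], of "\<lambda>v. v $ 1"]
    by (simp_all only: vector_3)
  then show ?thesis
    unfolding lie_bracket_def D[OF assms(1)] D[OF assms(2)] by (simp add: vec_eq_iff forall_3)
qed

text \<open>Here \<open>\<alpha>\<close> and \<open>\<beta>\<close> are determined by the condition that \<open>dz - \<alpha> dx - (\<beta> + x) dy\<close> annihilates \<open>F\<^sub>2\<close> and
  \<open>F\<^sub>3\<close>; since \<open>[F\<^sub>2, F\<^sub>3]\<close> is \<open>x2 * y3 - x3 * y2\<close> times the third coordinate field, the bracket relation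
  says that \<open>2 * s\<close> equals this number up to sign.\<close>

locale nil_frame =
  fixes F :: "3 \<Rightarrow> vector_field" and \<theta> :: "3 \<Rightarrow> real^3 \<Rightarrow> real^3 \<Rightarrow> real"
    and \<alpha> \<beta> x2 y2 x3 y3 s :: real
  assumes F1: "F 1 p = vector [0, 0, s]"
    and F2: "F 2 p = vector [x2, y2, \<alpha> * x2 + (\<beta> + p$1) * y2]"
    and F3: "F 3 p = vector [x3, y3, \<alpha> * x3 + (\<beta> + p$1) * y3]"
    and s: "s \<noteq> 0" "(2 * s)\<^sup>2 = (x2 * y3 - x3 * y2)\<^sup>2"
    and coframe: "dual_coframe F \<theta>"

lemma milnor_frame_imp_nil_frame:
  assumes "milnor_frame F" "dual_coframe F \<theta>"
  obtains \<alpha> \<beta> x2 y2 x3 y3 s where "nil_frame F \<theta> \<alpha> \<beta> x2 y2 x3 y3 s"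
proof -
  have li: "left_invariant (F i)" for i using assms(1) by (simp add: milnor_frame_def)
  define x2 y2 z2 x3 y3 z3 where "x2 = F 2 0 $ 1" and "y2 = F 2 0 $ 2" and "z2 = F 2 0 $ 3"
    and "x3 = F 3 0 $ 1" and "y3 = F 3 0 $ 2" and "z3 = F 3 0 $ 3"
  note defs = this
  define D where "D = x2 * y3 - x3 * y2"
  have br: "lie_bracket (F 2) (F 3) p = vector [0, 0, D]" for p
    using lie_bracket_left_invariant[OF li li] by (simp add: D_def defs)
  \<comment> \<open>The number e carries the sign of the bracket. With s = D / e, the metric depends
    on s only through its square.\<close>
  obtain e :: real where e: "e = 2 \<or> e = - 2" "\<And>p. lie_bracket (F 2) (F 3) p = e *\<^sub>R F 1 p"
    using assms(1) unfolding milnor_frame_def by metis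
  have F1: "F 1 p = vector [0, 0, D / e]" for p
  proof -
    have "F 1 p = (1 / e) *\<^sub>R (e *\<^sub>R F 1 p)" using e(1) by auto
    also have "\<dots> = (1 / e) *\<^sub>R vector [0, 0, D]" by (simp only: e(2)[symmetric] br)
    also have "\<dots> = vector [0, 0, D / e]" by (simp add: vec_eq_iff forall_3)
    finally show ?thesis .
  qed
  \<comment> \<open>A vanishing bracket would make F 1 zero, on which no linear form takes the value
    1.\<close>
  have D: "D \<noteq> 0"
  proof
    assume "D = 0"
    then have "F 1 0 = 0" by (simp add: F1 vec_eq_iff forall_3)
    moreover have "linear (\<theta> 1 0)" "\<theta> 1 0 (F 1 0) = 1"
      using assms(2) unfolding dual_coframe_def by auto
    ultimately show False by (simp add: linear_0)
  qed
  \<comment> \<open>Cramer's rule for the two equations \<open>z\<close> below.\<close>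
  define \<alpha> \<beta> where "\<alpha> = (z2 * y3 - z3 * y2) / D" and "\<beta> = (z3 * x2 - z2 * x3) / D"
  have z: "z2 = \<alpha> * x2 + \<beta> * y2" "z3 = \<alpha> * x3 + \<beta> * y3"
  proof -
    have "D * z2 = (\<alpha> * D) * x2 + (\<beta> * D) * y2" "D * z3 = (\<alpha> * D) * x3 + (\<beta> * D) * y3"
      using D by (simp_all add: \<alpha>_def \<beta>_def) (simp_all add: D_def algebra_simps)
    then have "D * z2 = D * (\<alpha> * x2 + \<beta> * y2)" "D * z3 = D * (\<alpha> * x3 + \<beta> * y3)"
      by (simp_all add: algebra_simps)
    then show "z2 = \<alpha> * x2 + \<beta> * y2" "z3 = \<alpha> * x3 + \<beta> * y3" using D by auto
  qed
  have "nil_frame F \<theta> \<alpha> \<beta> x2 y2 x3 y3 (D / e)"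
  proof
    show "F 2 p = vector [x2, y2, \<alpha> * x2 + (\<beta> + p$1) * y2]" for p
      using left_invariant_eq[OF li, of 2 p] by (simp add: defs[symmetric] z algebra_simps)
    show "F 3 p = vector [x3, y3, \<alpha> * x3 + (\<beta> + p$1) * y3]" for p
      using left_invariant_eq[OF li, of 3 p] by (simp add: defs[symmetric] z algebra_simps)
    have "2 * (D / e) = D \<or> 2 * (D / e) = - D" using e(1) by auto
    then show "(2 * (D / e))\<^sup>2 = (x2 * y3 - x3 * y2)\<^sup>2"
      unfolding D_def[symmetric] by auto
    show "D / e \<noteq> 0" using D e(1) by auto
  qed (use F1 assms(2) in auto)
  then show thesis by (rule that)
qed

context nil_frame
begin

definition D :: real where "D = x2 * y3 - x3 * y2"

lemma D: "D \<noteq> 0" "D\<^sup>2 = 4 * s\<^sup>2"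
  using s by (auto simp: D_def power_mult_distrib)

text \<open>The right-hand sides are the coefficients of u in the frame, found by Cramer's rule; the
  dual forms read them off.\<close>

lemma theta:
  "\<theta> 1 p u = (u$3 - \<alpha> * u$1 - (\<beta> + p$1) * u$2) / s"
  "\<theta> 2 p u = (y3 * u$1 - x3 * u$2) / D"
  "\<theta> 3 p u = (x2 * u$2 - y2 * u$1) / D"
proof -
  define w where "w = \<beta> + p$1"
  let ?c1 = "(u$3 - \<alpha> * u$1 - w * u$2) / s"
    and ?c2 = "(y3 * u$1 - x3 * u$2) / D" and ?c3 = "(x2 * u$2 - y2 * u$1) / D"
  have u: "u = ?c1 *\<^sub>R F 1 p + ?c2 *\<^sub>R F 2 p + ?c3 *\<^sub>R F 3 p"
  proof -
    have 1: "u$1 = ?c2 * x2 + ?c3 * x3" "u$2 = ?c2 * y2 + ?c3 * y3"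
      using D(1) by (simp_all add: field_simps) (simp_all add: D_def algebra_simps)
    have "u$3 = ?c1 * s + \<alpha> * u$1 + w * u$2" using s by simp
    also have "\<dots> = ?c1 * s + \<alpha> * (?c2 * x2 + ?c3 * x3) + w * (?c2 * y2 + ?c3 * y3)"
      by (simp only: 1[symmetric])
    also have "\<dots> = ?c1 * s + ?c2 * (\<alpha> * x2 + w * y2) + ?c3 * (\<alpha> * x3 + w * y3)"
      by algebra
    finally have 3: "u$3 = ?c1 * s + ?c2 * (\<alpha> * x2 + w * y2) + ?c3 * (\<alpha> * x3 + w * y3)" .
    show ?thesis
      unfolding vec_eq_iff forall_3 F1 F2 F3 w_def[symmetric]
      using 1 3 by simp
  qed
  have lin: "linear (\<theta> i p)" for i using coframe by (simp add: dual_coframe_def)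
  have dual: "\<theta> i p (F j p) = (if i = j then 1 else 0)" for i j
    using coframe by (simp add: dual_coframe_def)
  have "\<theta> i p u = ?c1 * \<theta> i p (F 1 p) + ?c2 * \<theta> i p (F 2 p) + ?c3 * \<theta> i p (F 3 p)" for i
    by (subst u) (simp only: linear_add[OF lin] linear_scale[OF lin] real_scaleR_def)
  then show "\<theta> 1 p u = (u$3 - \<alpha> * u$1 - (\<beta> + p$1) * u$2) / s"
    "\<theta> 2 p u = ?c2" "\<theta> 3 p u = ?c3"
    by (simp_all add: dual w_def)
qed

lemma diag_metric_eq:
  "diag_metric \<theta> a b c = heis_metric (a / s\<^sup>2) \<alpha> \<beta> ((b * y3\<^sup>2 + c * y2\<^sup>2) / D\<^sup>2)
     (- (b * x3 * y3 + c * x2 * y2) / D\<^sup>2) ((b * x3\<^sup>2 + c * x2\<^sup>2) / D\<^sup>2)"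
  using s(1) D(1)
  by (simp add: fun_eq_iff diag_metric_def heis_metric_def theta field_simps power2_eq_square)

text \<open>The inverse of h is the horizontal cometric: the products of the x and y components of F
  2, divided by b, plus those of F 3, divided by c.\<close>

lemma heis_coeffs_frame:
  assumes "a > 0" "b > 0" "c > 0"
  shows "heis_coeffs (a / s\<^sup>2) ((b * y3\<^sup>2 + c * y2\<^sup>2) / D\<^sup>2)
     (- (b * x3 * y3 + c * x2 * y2) / D\<^sup>2) ((b * x3\<^sup>2 + c * x2\<^sup>2) / D\<^sup>2)
     (x2\<^sup>2 / b + x3\<^sup>2 / c) (x2 * y2 / b + x3 * y3 / c) (y2\<^sup>2 / b + y3\<^sup>2 / c)"
proof
  show "a / s\<^sup>2 \<noteq> 0" using assms s by simp
qed (use assms D(1) in \<open>simp_all add: field_simps power2_eq_square\<close>, simp_all add: D_def algebra_simps)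

definition cometric :: "real \<Rightarrow> real \<Rightarrow> real \<Rightarrow> real^3 \<Rightarrow> real^3^3" where
  "cometric a b c p = (\<chi> i j. F 1 p $ i * F 1 p $ j / a + F 2 p $ i * F 2 p $ j / b + F 3 p $ i * F 3 p $ j / c)"

lemma cogram_diag_metric:
  assumes "a > 0" "b > 0" "c > 0"
  shows "cogram (diag_metric \<theta> a b c) p = cometric a b c p"
proof -
  interpret heis_coeffs "a / s\<^sup>2" \<alpha> \<beta> "(b * y3\<^sup>2 + c * y2\<^sup>2) / D\<^sup>2" "- (b * x3 * y3 + c * x2 * y2) / D\<^sup>2"
    "(b * x3\<^sup>2 + c * x2\<^sup>2) / D\<^sup>2" "x2\<^sup>2 / b + x3\<^sup>2 / c" "x2 * y2 / b + x3 * y3 / c" "y2\<^sup>2 / b + y3\<^sup>2 / c"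
    by (rule heis_coeffs_frame[OF assms])
  show ?thesis
    unfolding diag_metric_eq cogram_entry
    using assms s(1)
    by (simp add: vec_eq_iff forall_3 cometric_def F1 F2 F3 field_simps power2_eq_square)
qed

lemma vol_density_diag_metric:
  assumes "a > 0" "b > 0" "c > 0"
  shows "vol_density (diag_metric \<theta> a b c) p = sqrt (a * b * c) / (2 * s\<^sup>2)"
proof -
  interpret heis_coeffs "a / s\<^sup>2" \<alpha> \<beta> "(b * y3\<^sup>2 + c * y2\<^sup>2) / D\<^sup>2" "- (b * x3 * y3 + c * x2 * y2) / D\<^sup>2"
    "(b * x3\<^sup>2 + c * x2\<^sup>2) / D\<^sup>2" "x2\<^sup>2 / b + x3\<^sup>2 / c" "x2 * y2 / b + x3 * y3 / c" "y2\<^sup>2 / b + y3\<^sup>2 / c"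
    by (rule heis_coeffs_frame[OF assms])
  have "(b * y3\<^sup>2 + c * y2\<^sup>2) / D\<^sup>2 * ((b * x3\<^sup>2 + c * x2\<^sup>2) / D\<^sup>2) - (- (b * x3 * y3 + c * x2 * y2) / D\<^sup>2)\<^sup>2
    = b * c * D\<^sup>2 / (D\<^sup>2 * D\<^sup>2)"
    by (simp add: field_simps power2_eq_square) (simp add: D_def field_simps power2_eq_square)
  also have "\<dots> = b * c / D\<^sup>2" using D(1) by (simp add: power2_eq_square)
  finally have "det (gram (diag_metric \<theta> a b c) p) = a / s\<^sup>2 * (b * c / D\<^sup>2)"
    unfolding diag_metric_eq det_gram by simp
  \<comment> \<open>The Milnor normalization, in the form that D squared is 4 s squared, removes
    D.\<close>
  also have "\<dots> = (a * b * c) / (2 * s\<^sup>2)\<^sup>2"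
    unfolding D(2) by (simp add: power2_eq_square)
  finally have "vol_density (diag_metric \<theta> a b c) p = sqrt (a * b * c / (2 * s\<^sup>2)\<^sup>2)"
    by (simp only: vol_density_def)
  then show ?thesis by (simp only: real_sqrt_divide real_sqrt_abs) simp
qed

text \<open>In \<open>ricci_heis\<close> the determinant of (k_ij) is 4 s^2 / (b c), and this 4
  produces the constant 2. Diagonal values suffice to read off the equations for A, B and C.\<close>

lemma ricci_diag_metric:
  assumes "a > 0" "b > 0" "c > 0"
  shows "ricci (diag_metric \<theta> a b c) p (F 1 p) (F 1 p) = 2 * a\<^sup>2 / (b * c)"
    "ricci (diag_metric \<theta> a b c) p (F 2 p) (F 2 p) = - 2 * a / c"
    "ricci (diag_metric \<theta> a b c) p (F 3 p) (F 3 p) = - 2 * a / b"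
proof -
  interpret heis_coeffs "a / s\<^sup>2" \<alpha> \<beta> "(b * y3\<^sup>2 + c * y2\<^sup>2) / D\<^sup>2" "- (b * x3 * y3 + c * x2 * y2) / D\<^sup>2"
    "(b * x3\<^sup>2 + c * x2\<^sup>2) / D\<^sup>2" "x2\<^sup>2 / b + x3\<^sup>2 / c" "x2 * y2 / b + x3 * y3 / c" "y2\<^sup>2 / b + y3\<^sup>2 / c"
    by (rule heis_coeffs_frame[OF assms])
  have d: "(x2\<^sup>2 / b + x3\<^sup>2 / c) * (y2\<^sup>2 / b + y3\<^sup>2 / c) - (x2 * y2 / b + x3 * y3 / c)\<^sup>2 = 4 * s\<^sup>2 / (b * c)"
    using assms unfolding D(2)[symmetric]
    by (simp add: field_simps power2_eq_square) (simp add: D_def field_simps power2_eq_square)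
  show "ricci (diag_metric \<theta> a b c) p (F 1 p) (F 1 p) = 2 * a\<^sup>2 / (b * c)"
    unfolding diag_metric_eq ricci_heis d using assms s(1) by (simp add: F1 power2_eq_square)
  have "(y2\<^sup>2 / b + y3\<^sup>2 / c) * (x2 * x2) - (x2 * y2 / b + x3 * y3 / c) * (x2 * y2 + y2 * x2)
      + (x2\<^sup>2 / b + x3\<^sup>2 / c) * (y2 * y2) = 4 * s\<^sup>2 / c"
    using assms unfolding D(2)[symmetric]
    by (simp add: field_simps power2_eq_square) (simp add: D_def field_simps power2_eq_square)
  then show "ricci (diag_metric \<theta> a b c) p (F 2 p) (F 2 p) = - 2 * a / c"
    unfolding diag_metric_eq ricci_heis d using assms s(1) by (simp add: F2)
  have "(y2\<^sup>2 / b + y3\<^sup>2 / c) * (x3 * x3) - (x2 * y2 / b + x3 * y3 / c) * (x3 * y3 + y3 * x3)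
      + (x2\<^sup>2 / b + x3\<^sup>2 / c) * (y3 * y3) = 4 * s\<^sup>2 / b"
    using assms unfolding D(2)[symmetric]
    by (simp add: field_simps power2_eq_square) (simp add: D_def field_simps power2_eq_square)
  then show "ricci (diag_metric \<theta> a b c) p (F 3 p) (F 3 p) = - 2 * a / b"
    unfolding diag_metric_eq ricci_heis d using assms s(1) by (simp add: F3)
qed

lemma diag_metric_frame:
  "diag_metric \<theta> a b c p (F 1 p) (F 1 p) = a"
  "diag_metric \<theta> a b c p (F 2 p) (F 2 p) = b"
  "diag_metric \<theta> a b c p (F 3 p) (F 3 p) = c"
  using coframe by (auto simp: diag_metric_def dual_coframe_def)

text \<open>On the frame at the identity the flow reads A' = - 4 A^2 / (B C), B' = 4 A / C, C' = 4 A
  / B. Hence A B and A C have derivative 0, and B C has derivative 8 A > 0.\<close>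

lemma ricci_flow_conserved:
  assumes pos: "\<And>t. 0 \<le> t \<Longrightarrow> A t > 0 \<and> B t > 0 \<and> C t > 0 \<and> g t = diag_metric \<theta> (A t) (B t) (C t)"
    and flow: "ricci_flow_on {0..} g" and st: "0 \<le> r" "r \<le> t"
  shows "A r * B r = A t * B t" "A r * C r = A t * C t" "B r * C r \<le> B t * C t"
proof -
  have d: "((\<lambda>s. g s 0 (F i 0) (F i 0)) has_real_derivative - 2 * ricci (g t) 0 (F i 0) (F i 0)) (at t within {0..})"
    if "0 \<le> t" for t i using flow that by (simp add: ricci_flow_on_def)
  have dA: "(A has_real_derivative - 4 * (A t)\<^sup>2 / (B t * C t)) (at t within {0..})"
    and dB: "(B has_real_derivative 4 * A t / C t) (at t within {0..})"
    and dC: "(C has_real_derivative 4 * A t / B t) (at t within {0..})" if t: "0 \<le> t" for t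
  proof -
    have tr: "(X has_real_derivative y) (at t within {0..})"
      if "\<And>s. 0 \<le> s \<Longrightarrow> g s 0 (F i 0) (F i 0) = X s" "- 2 * ricci (g t) 0 (F i 0) (F i 0) = y" for X y i
      using has_field_derivative_transform_within[OF d[OF t, of i], of 1 X] that t by simp
    show "(A has_real_derivative - 4 * (A t)\<^sup>2 / (B t * C t)) (at t within {0..})"
      by (rule tr[of 1]) (use pos t in \<open>auto simp: ricci_diag_metric diag_metric_frame\<close>)
    show "(B has_real_derivative 4 * A t / C t) (at t within {0..})"
      by (rule tr[of 2]) (use pos t in \<open>auto simp: ricci_diag_metric diag_metric_frame\<close>)
    show "(C has_real_derivative 4 * A t / B t) (at t within {0..})"
      by (rule tr[of 3]) (use pos t in \<open>auto simp: ricci_diag_metric diag_metric_frame\<close>)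
  qed
  have nz: "A t \<noteq> 0" "B t \<noteq> 0" "C t \<noteq> 0" if "0 \<le> t" for t using pos[OF that] by auto
  have const: "f r = f t" if "\<And>t. 0 \<le> t \<Longrightarrow> (f has_real_derivative 0) (at t within {0..})" for f :: "real \<Rightarrow> real"
  proof -
    have "\<exists>c. \<forall>x\<in>{0..}. f x = c"
      by (rule has_field_derivative_zero_constant) (use that in auto)
    then show ?thesis using st by auto
  qed
  show "A r * B r = A t * B t"
  proof (rule const)
    show "((\<lambda>t. A t * B t) has_real_derivative 0) (at t within {0..})" if "0 \<le> t" for t
      by (rule DERIV_cong[OF DERIV_mult[OF dA dB]])
        (use that nz in \<open>auto simp: field_simps power2_eq_square\<close>)
  qed
  show "A r * C r = A t * C t"
  proof (rule const)
    show "((\<lambda>t. A t * C t) has_real_derivative 0) (at t within {0..})" if "0 \<le> t" for t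
      by (rule DERIV_cong[OF DERIV_mult[OF dA dC]])
        (use that nz in \<open>auto simp: field_simps power2_eq_square\<close>)
  qed
  have dBC: "((\<lambda>t. B t * C t) has_real_derivative 8 * A t) (at t within {0..})" if "0 \<le> t" for t
    by (rule DERIV_cong[OF DERIV_mult[OF dB dC]]) (use that nz in auto)
  have "((\<lambda>t. B t * C t) has_derivative (\<lambda>h. h * (8 * A x))) (at x within {r..t})" if "r \<le> x" "x \<le> t" for x
    using has_field_derivative_subset[OF dBC, of x "{r..t}"] that st
    by (auto simp: has_field_derivative_def mult_commute_abs)
  from mvt_very_simple[OF st(2) this]
  obtain x where x: "x \<in> {r..t}" "B t * C t - B r * C r = (t - r) * (8 * A x)" by auto
  have "0 \<le> (t - r) * (8 * A x)" using x(1) st pos[of x] by (auto intro!: mult_nonneg_nonneg)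
  then show "B r * C r \<le> B t * C t" using x(2) by linarith
qed

section \<open>Order of cometrics and reduction to the divergence form\<close>

lemma cometric_inner:
  "(cometric a b c p *v u) \<bullet> v
    = (F 1 p \<bullet> u) * (F 1 p \<bullet> v) / a + (F 2 p \<bullet> u) * (F 2 p \<bullet> v) / b + (F 3 p \<bullet> u) * (F 3 p \<bullet> v) / c"
  by (simp add: cometric_def matrix_vector_mult_def inner_vec_def sum_3 add_divide_distrib algebra_simps)

text \<open>Both forms are diagonal in the same frame, so comparing coefficients is enough.\<close>

lemma cometric_le:
  assumes "1 / a' \<le> k / a" "1 / b' \<le> k / b" "1 / c' \<le> k / c"
  shows "(cometric a' b' c' p *v x) \<bullet> x \<le> k * ((cometric a b c p *v x) \<bullet> x)"
proof -
  have "y * y / d' \<le> k * (y * y / d)" if "1 / d' \<le> k / d" for y d d' :: real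
    using mult_left_mono[OF that, of "y * y"] by (simp add: mult.commute)
  then show ?thesis
    unfolding cometric_inner distrib_left using assms by (intro add_mono) blast+
qed

lemma Ck_on_1_cometric: "Ck_on 1 U (\<lambda>p. cometric a b c p $ i $ j)"
proof -
  have quad: "Ck_on 1 U (quad \<beta> c0 c1 0)" for c0 c1
  proof (rule Ck_on_1_I)
    show "quad \<beta> c0 c1 0 differentiable (at p)" for p
      using has_derivative_quad unfolding differentiable_def by blast
    show "continuous_on U (partial i (quad \<beta> c0 c1 0))" for i
    proof -
      have "partial i (quad \<beta> c0 c1 0) = (\<lambda>_. if i = 1 then c1 else 0)"
        by (simp add: fun_eq_iff partial_quad)
      then show ?thesis by simp
    qed
  qed
  have const: "Ck_on 1 U (\<lambda>p. c)" for c
    using quad[of c 0] by (simp only: quad_def[abs_def] mult_zero_left add_0_right)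
  have affine: "Ck_on 1 U (\<lambda>p. c0 + (\<beta> + p$1) * c1)" for c0 c1
    using quad[of c0 c1] by (simp only: quad_def[abs_def] mult_zero_left add_0_right mult.commute[of c1])
  have "\<forall>k i. Ck_on 1 U (\<lambda>p. F k p $ i)"
    unfolding forall_3 F1 F2 F3 vector_3 by (intro conjI const affine)
  then have F: "Ck_on 1 U (\<lambda>p. F k p $ i)" for k i by blast
  \<comment> \<open>Written as a sum over the frame index, the entry is covered by the closure
    lemmas for sums and products.\<close>
  have "Ck_on 1 U (\<lambda>p. \<Sum>k\<in>UNIV. (vector [1 / a, 1 / b, 1 / c] :: real^3) $ k * (F k p $ i * F k p $ j))"
    by (intro Ck_on_1_sum Ck_on_1_mult const F) auto
  then show ?thesis by (simp only: sum_3 vector_3 cometric_def vec_lambda_beta mult_1 times_divide_eq_left)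
qed

text \<open>The constant density leaves the derivative in \<open>laplacian\<close> and cancels
  against the denominator.\<close>

lemma torsion_problem_diag_metric:
  assumes pos: "a > 0" "b > 0" "c > 0"
    and \<Omega>: "precompact_smooth_domain \<Omega>" and u: "torsion_function (diag_metric \<theta> a b c) \<Omega> u"
  shows "torsion_problem \<Omega> (cometric a b c) u"
proof
  let ?g = "diag_metric \<theta> a b c" and ?M = "cometric a b c"
  show \<Omega>o: "open \<Omega>" and "bounded \<Omega>"
    using \<Omega> by (auto simp: precompact_smooth_domain_def compact_eq_bounded_closed
        intro: bounded_subset[OF _ closure_subset])
  show u2: "Ck_on 2 \<Omega> u" and "continuous_on (closure \<Omega>) u"
    and "p \<in> frontier \<Omega> \<Longrightarrow> u p = 0" for p
    using u by (auto simp: torsion_function_def)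
  show "Ck_on 1 \<Omega> (\<lambda>p. ?M p $ i $ j)" for i j by (rule Ck_on_1_cometric)
  show "(?M p *v x) \<bullet> y = (?M p *v y) \<bullet> x" for p x y
    by (simp add: cometric_inner mult.commute)
  show "0 \<le> (?M p *v x) \<bullet> x" for p x
    unfolding cometric_inner using pos by (intro add_nonneg_nonneg divide_nonneg_pos) auto
  show "divergence (\<lambda>q. ?M q *v grad u q) p = - 1" if p: "p \<in> \<Omega>" for p
  proof -
    define \<rho> where "\<rho> = sqrt (a * b * c) / (2 * s\<^sup>2)"
    have \<rho>: "\<rho> > 0" using pos s(1) by (simp add: \<rho>_def)
    have "Ck_on 1 \<Omega> (\<lambda>q. \<Sum>j\<in>UNIV. ?M q $ i $ j * partial j u q)" for i
      using Ck_on_1_mult[OF Ck_on_1_cometric Ck_on_2_D(2)[OF u2]] by (intro Ck_on_1_sum) auto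
    note diff = Ck_on_1_D(1)[OF this p]
    have "- 1 = laplacian ?g u p" using u p by (simp add: torsion_function_def)
    also have "\<dots> = (\<Sum>i\<in>UNIV. partial i (\<lambda>q. \<rho> * (\<Sum>j\<in>UNIV. ?M q $ i $ j * partial j u q)) p) / \<rho>"
      unfolding laplacian_def vol_density_diag_metric[OF pos] cogram_diag_metric[OF pos] \<rho>_def ..
    also have "\<dots> = (\<Sum>i\<in>UNIV. partial i (\<lambda>q. \<Sum>j\<in>UNIV. ?M q $ i $ j * partial j u q) p)"
      using \<rho> by (simp add: partial_mult[OF _ diff] partial_const flip: sum_distrib_left)
    finally show ?thesis by (simp add: divergence_def matrix_vector_mult_def)
  qed
qed

lemma riem_volume_diag_metric:
  assumes "a > 0" "b > 0" "c > 0" "\<Omega> \<in> sets borel"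
  shows "riem_volume (diag_metric \<theta> a b c) \<Omega> = sqrt (a * b * c) / (2 * s\<^sup>2) * measure lborel \<Omega>"
  unfolding riem_volume_def riem_measure_def vol_density_diag_metric[OF assms(1-3)]
  using assms by (subst measure_density_const) auto

lemma torsional_rigidity_diag_metric:
  assumes "a > 0" "b > 0" "c > 0" "set_integrable lborel \<Omega> u"
  shows "torsional_rigidity (diag_metric \<theta> a b c) \<Omega> u
    = sqrt (a * b * c) / (2 * s\<^sup>2) * (LINT p:\<Omega>|lborel. u p)"
proof -
  have "(\<lambda>p. indicator \<Omega> p *\<^sub>R u p) \<in> borel_measurable lborel"
    using assms(4) unfolding set_integrable_def by (rule borel_measurable_integrable)
  then show ?thesis
    unfolding torsional_rigidity_def riem_measure_def vol_density_diag_metric[OF assms(1-3)]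
      set_lebesgue_integral_def
    using assms by (subst integral_density) auto
qed

end

section \<open>Monotonicity along the Ricci flow\<close>

theorem corollary6p2:
  fixes F :: "3 \<Rightarrow> vector_field"
    and \<theta> :: "3 \<Rightarrow> real^3 \<Rightarrow> real^3 \<Rightarrow> real"
    and A\<^sub>0 B\<^sub>0 C\<^sub>0 :: real
    and A B C :: "real \<Rightarrow> real"
    and g :: "real \<Rightarrow> 3 metric"
    and \<Omega> :: "(real^3) set"
    and E :: "real \<Rightarrow> real^3 \<Rightarrow> real"
  assumes "milnor_frame F" and "dual_coframe F \<theta>"
    and "A\<^sub>0 > 0" and "B\<^sub>0 > 0" and "C\<^sub>0 > 0"
    and "g 0 = diag_metric \<theta> A\<^sub>0 B\<^sub>0 C\<^sub>0"
    and "\<forall>t\<ge>0. A t > 0 \<and> B t > 0 \<and> C t > 0 \<and> g t = diag_metric \<theta> (A t) (B t) (C t)"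
    and "ricci_flow_on {0..} g"
    and "precompact_smooth_domain \<Omega>"
    and "\<forall>t\<ge>0. torsion_function (g t) \<Omega> (E t)"
  shows "mono_on {0..}
           (\<lambda>t. riem_volume (g t) \<Omega> * torsional_rigidity (g t) \<Omega> (E t))
       \<and> antimono_on {0..}
           (\<lambda>t. torsional_rigidity (g t) \<Omega> (E t) / riem_volume (g t) \<Omega> ^ 3)"
proof -
  obtain \<alpha> \<beta> x2 y2 x3 y3 s where "nil_frame F \<theta> \<alpha> \<beta> x2 y2 x3 y3 s"
    using milnor_frame_imp_nil_frame[OF assms(1,2)] .
  then interpret nil_frame F \<theta> \<alpha> \<beta> x2 y2 x3 y3 s .
  have pos: "A t > 0" "B t > 0" "C t > 0" and g: "g t = diag_metric \<theta> (A t) (B t) (C t)" if "0 \<le> t" for t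
    using assms(7) that by auto
  define J where "J t = (LINT p:\<Omega>|lborel. E t p)" for t
  define \<rho> where "\<rho> t = sqrt (A t * B t * C t) / (2 * s\<^sup>2)" for t
  have \<rho>: "\<rho> t > 0" if "0 \<le> t" for t using pos[OF that] s(1) by (simp add: \<rho>_def)
  have \<rho>2: "(\<rho> t)\<^sup>2 = A t * B t * C t / (2 * s\<^sup>2)\<^sup>2" if "0 \<le> t" for t
    using pos[OF that] by (simp add: \<rho>_def power_divide)
  have \<Omega>: "\<Omega> \<in> sets borel" using assms(9) by (simp add: precompact_smooth_domain_def)
  have tp: "torsion_problem \<Omega> (cometric (A t) (B t) (C t)) (E t)" if "0 \<le> t" for t
    by (rule torsion_problem_diag_metric[OF pos[OF that] assms(9)]) (use assms(10) g that in auto)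
  have V: "riem_volume (g t) \<Omega> = \<rho> t * measure lborel \<Omega>" if "0 \<le> t" for t
    using riem_volume_diag_metric[OF pos[OF that] \<Omega>] that by (simp add: g \<rho>_def)
  have T: "torsional_rigidity (g t) \<Omega> (E t) = \<rho> t * J t" if "0 \<le> t" for t
    using torsional_rigidity_diag_metric[OF pos[OF that] torsion_problem.set_integrable_u[OF tp[OF that]]] that
    by (simp add: g \<rho>_def J_def)
  have main: "(\<rho> r)\<^sup>2 * J r \<le> (\<rho> t)\<^sup>2 * J t" "J t / (\<rho> t)\<^sup>2 \<le> J r / (\<rho> r)\<^sup>2" if r: "0 \<le> r" "r \<le> t" for r t
  proof -
    have t: "0 \<le> t" using r by simp
    note p = pos[OF r(1)] pos[OF t]
    have cons: "A r * B r = A t * B t" "A r * C r = A t * C t" "B r * C r \<le> B t * C t"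
      by (rule ricci_flow_conserved[of A B C g, OF _ assms(8) r]; use assms(7) in blast)+
    let ?c = "(\<rho> t)\<^sup>2 / (\<rho> r)\<^sup>2"
    have c: "?c = (A t * B t * C t) / (A r * B r * C r)"
      using s(1) p by (simp add: \<rho>2 r(1) t)
    have c0: "?c > 0" using \<rho>[OF r(1)] \<rho>[OF t] by simp
    \<comment> \<open>For cometric(t) <= ?c cometric(r): A B C times A is (A B)(A C), which is
      conserved, so the central direction gives equality. Horizontally the gap is the growth of B
      C.\<close>
    have "A r * B r * C r * A r = A t * (A t * B t * C t)" using cons(1,2) by algebra
    then have rA: "?c / A r = 1 / A t" using p unfolding c by simp
    have "A t * B t * C t * (B r * C r) = A r * B r * C r * B r * C t" using cons(1) by algebra
    then have "?c / B r = C t / (B r * C r)" using p unfolding c by (simp add: field_simps)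
    also have "\<dots> \<ge> C t / (B t * C t)" using p cons(3) by (intro divide_left_mono) auto
    finally have rB: "1 / B t \<le> ?c / B r" using p by simp
    have "A t * B t * C t * (B r * C r) = A r * B r * C r * C r * B t" using cons(2) by algebra
    then have "?c / C r = B t / (B r * C r)" using p unfolding c by (simp add: field_simps)
    also have "\<dots> \<ge> B t / (B t * C t)" using p cons(3) by (intro divide_left_mono) auto
    finally have rC: "1 / C t \<le> ?c / C r" using p by simp
    have 1: "J r \<le> ?c * J t"
      unfolding J_def
      by (rule torsion_comparison[OF tp[OF r(1)] tp[OF t] c0 cometric_le]) (use rA rB rC in auto)
    \<comment> \<open>In the reverse comparison the horizontal directions give equality, and the
      growth of B C is spent on the central one.\<close>
    have "?c / A t = (B t * C t) / (A r * (B r * C r))" using p unfolding c by simp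
    also have "\<dots> \<ge> (B r * C r) / (A r * (B r * C r))" using p cons(3) by (intro divide_right_mono) auto
    finally have tA: "1 / A r \<le> ?c / A t" using p by simp
    have "?c / B t = (A t * C t) / (A r * C r * B r)" using p unfolding c by simp
    also have "\<dots> = 1 / B r" unfolding cons(2) using p by simp
    finally have tB: "?c / B t = 1 / B r" .
    have "?c / C t = (A t * B t) / (A r * B r * C r)" using p unfolding c by simp
    also have "\<dots> = 1 / C r" unfolding cons(1) using p by simp
    finally have tC: "?c / C t = 1 / C r" .
    have 2: "J t \<le> ?c * J r"
      unfolding J_def
      by (rule torsion_comparison[OF tp[OF t] tp[OF r(1)] c0 cometric_le]) (use tA tB tC in auto)
    show "(\<rho> r)\<^sup>2 * J r \<le> (\<rho> t)\<^sup>2 * J t" "J t / (\<rho> t)\<^sup>2 \<le> J r / (\<rho> r)\<^sup>2"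
      using 1 2 \<rho>[OF r(1)] \<rho>[OF t] by (simp_all add: field_simps)
  qed
  \<comment> \<open>The sign suffices for the division below: the quotient by the cube of a zero
    volume would be 0 at all times.\<close>
  have m: "0 \<le> measure lborel \<Omega>" by simp
  show ?thesis
  proof
    show "mono_on {0..} (\<lambda>t. riem_volume (g t) \<Omega> * torsional_rigidity (g t) \<Omega> (E t))"
    proof (rule mono_onI)
      fix r t :: real assume rt: "r \<in> {0..}" "t \<in> {0..}" "r \<le> t"
      then show "riem_volume (g r) \<Omega> * torsional_rigidity (g r) \<Omega> (E r)
          \<le> riem_volume (g t) \<Omega> * torsional_rigidity (g t) \<Omega> (E t)"
        using mult_left_mono[OF main(1)[of r t] m] by (simp add: V T power2_eq_square algebra_simps)
    qed
    show "antimono_on {0..} (\<lambda>t. torsional_rigidity (g t) \<Omega> (E t) / riem_volume (g t) \<Omega> ^ 3)"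
    proof (rule monotone_onI)
      fix r t :: real assume rt: "r \<in> {0..}" "t \<in> {0..}" "r \<le> t"
      have eq: "torsional_rigidity (g t) \<Omega> (E t) / riem_volume (g t) \<Omega> ^ 3
          = (J t / (\<rho> t)\<^sup>2) / measure lborel \<Omega> ^ 3" if "0 \<le> t" for t
        using \<rho>[OF that] by (simp add: V T that power_mult_distrib power3_eq_cube power2_eq_square)
      show "torsional_rigidity (g t) \<Omega> (E t) / riem_volume (g t) \<Omega> ^ 3
          \<le> torsional_rigidity (g r) \<Omega> (E r) / riem_volume (g r) \<Omega> ^ 3"
        using rt divide_right_mono[OF main(2)[of r t] zero_le_power[OF m, of 3]]
        by (simp only: eq atLeast_iff)
    qed
  qed
qed

end
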